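(* Let $\rho>\max\{0,-\alpha\}$, $0<\gamma<\sigma\le 1$, $U(\infty)=V(\infty)=\infty$, $p<0$, $\frac1p+\frac1q=1$ (so $0<q<1$). For all measurable $f\ge 0$ on $\mathbf{R}_+$ and all sequences $a_n\ge 0$ ($n\in\mathbf{N}$) with $0<\|f\|_{p,\Phi_\delta}<\infty$ and $0<\|a\|_{q,\Psi_\beta}<\infty$, the following equivalent inequalities hold: $$\sum_{n=1}^\infty\int_0^\infty K_\delta(x,n)\,a_n f(x)\,dx>k(\sigma)\,\|f\|_{p,\Phi_\delta}\|a\|_{q,\Psi_\beta},$$ $$\left\{\sum_{n=1}^\infty\frac{\nu_{n+1}}{(V_n-\beta)^{1-p\sigma}}\left[\int_0^\infty K_\delta(x,n)f(x)\,dx\right]^p\right\}^{1/p}>k(\sigma)\,\|f\|_{p,\Phi_\delta},$$ $$\left\{\int_0^\infty\frac{\mu(x)}{U^{1-q\delta\sigma}(x)}\left[\sum_{n=1}^\infty K_\delta(x,n)a_n\right]^q dx\right\}^{1/q}>k(\sigma)\,\|a\|_{q,\Psi_\beta}.$$ Moreover the constant factor $k(\sigma)$ is the best possible in each of them: for the given parameters, $\mu$ and $\{\nu_n\}$, in none of these inequalities can $k(\sigma)$ be replaced by a larger constant so that the inequality remains valid for all such $f$ and $a$.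
   Context: Setting. $\mathbf{R}_+=(0,\infty)$, $\mathbf{N}=\{1,2,\dots\}$, and $\alpha,\rho,\gamma,\sigma,\beta$ are real. $\{\nu_n\}_{n\ge1}$ is a decreasing (i.e. $\nu_{n+1}\le\nu_n$) sequence of positive reals, $V_n=\sum_{j=1}^n\nu_j$, $V(\infty)=\sum_{j=1}^\infty\nu_j$, and $\beta\le\nu_1/2$. $\mu$ is a positive continuous function on $\mathbf{R}_+$ with $U(x):=\int_0^x\mu(t)\,dt<\infty$ for all $x>0$, and $U(\infty)=\lim_{x\to\infty}U(x)$. $\delta\in\{-1,1\}$ is fixed. Powers such as $U^{s}(x)$ mean $(U(x))^{s}$. Kernel: with $\operatorname{csch}(u)=\frac{2}{e^u-e^{-u}}$ ($u>0$), $$K_\delta(x,n):=\frac{\operatorname{csch}\big(\rho\,U^{\delta\gamma}(x)(V_n-\beta)^\gamma\big)}{e^{\alpha U^{\delta\gamma}(x)(V_n-\beta)^\gamma}}.$$ Constant: $$k(\sigma):=\int_0^\infty\frac{\operatorname{csch}(\rho t^\gamma)}{e^{\alpha t^\gamma}}t^{\sigma-1}dt=\frac{2\Gamma(\sigma/\gamma)}{\gamma(2\rho)^{\sigma/\gamma}}\,\zeta\!\left(\frac{\sigma}{\gamma},\frac{\alpha+\rho}{2\rho}\right),$$ where $\zeta(s,a)=\sum_{k=0}^\infty (k+a)^{-s}$ ($s>1$, $a>0$) is the Hurwitz zeta function. Formal norms: $\Phi_\delta(x):=\frac{U^{p(1-\delta\sigma)-1}(x)}{\mu^{p-1}(x)}$,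 $\Psi_\beta(n):=\frac{(V_n-\beta)^{q(1-\sigma)-1}}{\nu_{n+1}^{q-1}}$, $\|f\|_{p,\Phi_\delta}=\left(\int_0^\infty\Phi_\delta(x)f^p(x)\,dx\right)^{1/p}$, $\|a\|_{q,\Psi_\beta}=\left(\sum_{n=1}^\infty\Psi_\beta(n)a_n^q\right)^{1/q}$. All quantities take values in $[0,\infty]$, with the usual conventions $0^r=+\infty$ and $(+\infty)^r=0$ for $r<0$. *)

theory Defs
  imports "HOL-Analysis.Analysis"
begin

(* Real powers on [0,\<infinity>]: for r < 0, 0 to the r is \<infinity> and \<infinity> to the r is 0. *)
definition ennpowr :: "ennreal \<Rightarrow> real \<Rightarrow> ennreal" where
  "ennpowr x r =
     (if r = 0 then 1
      else if x = 0 then (if r < 0 then \<infinity> else 0)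
      else if x = \<infinity> then (if r < 0 then 0 else \<infinity>)
      else ennreal (enn2real x powr r))"

definition csch :: "real \<Rightarrow> real" where
  "csch u = 2 / (exp u - exp (- u))"

definition hurwitz_zeta :: "real \<Rightarrow> real \<Rightarrow> real" where
  "hurwitz_zeta s a = (\<Sum>k. (real k + a) powr (- s))"

(* Sequences are indexed by 1, 2, ...; the value at 0 is never used. *)
definition psum :: "(nat \<Rightarrow> real) \<Rightarrow> nat \<Rightarrow> real" where
  "psum \<nu> n = (\<Sum>j = 1..n. \<nu> j)"

definition prim :: "(real \<Rightarrow> real) \<Rightarrow> real \<Rightarrow> real" where
  "prim \<mu> x = (LINT t:{0<..<x}|lborel. \<mu> t)"

definition csch_kernel ::
  "real \<Rightarrow> real \<Rightarrow> real \<Rightarrow> real \<Rightarrow> real \<Rightarrow> (real \<Rightarrow> real) \<Rightarrow> (nat \<Rightarrow> real) \<Rightarrow> real \<Rightarrow> nat \<Rightarrow> real" where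
  "csch_kernel \<alpha> \<rho> \<gamma> \<beta> \<delta> \<mu> \<nu> x n =
     csch (\<rho> * prim \<mu> x powr (\<delta> * \<gamma>) * (psum \<nu> n - \<beta>) powr \<gamma>)
       / exp (\<alpha> * prim \<mu> x powr (\<delta> * \<gamma>) * (psum \<nu> n - \<beta>) powr \<gamma>)"

definition kconst :: "real \<Rightarrow> real \<Rightarrow> real \<Rightarrow> real \<Rightarrow> ennreal" where
  "kconst \<alpha> \<rho> \<gamma> \<sigma> =
     (\<integral>\<^sup>+t\<in>{0<..}. ennreal (csch (\<rho> * t powr \<gamma>) / exp (\<alpha> * t powr \<gamma>) * t powr (\<sigma> - 1)) \<partial>lebesgue)"

definition Phi :: "real \<Rightarrow> real \<Rightarrow> real \<Rightarrow> (real \<Rightarrow> real) \<Rightarrow> real \<Rightarrow> real" where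
  "Phi p \<sigma> \<delta> \<mu> x = prim \<mu> x powr (p * (1 - \<delta> * \<sigma>) - 1) / \<mu> x powr (p - 1)"

definition Psi :: "real \<Rightarrow> real \<Rightarrow> real \<Rightarrow> (nat \<Rightarrow> real) \<Rightarrow> nat \<Rightarrow> real" where
  "Psi q \<sigma> \<beta> \<nu> n = (psum \<nu> n - \<beta>) powr (q * (1 - \<sigma>) - 1) / \<nu> (Suc n) powr (q - 1)"

definition fnorm :: "real \<Rightarrow> (real \<Rightarrow> real) \<Rightarrow> (real \<Rightarrow> real) \<Rightarrow> ennreal" where
  "fnorm p w f =
     ennpowr (\<integral>\<^sup>+x\<in>{0<..}. ennreal (w x) * ennpowr (ennreal (f x)) p \<partial>lebesgue) (1 / p)"

definition anorm :: "real \<Rightarrow> (nat \<Rightarrow> real) \<Rightarrow> (nat \<Rightarrow> real) \<Rightarrow> ennreal" where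
  "anorm q w a =
     ennpowr (\<Sum>n. ennreal (w (Suc n)) * ennpowr (ennreal (a (Suc n))) q) (1 / q)"

definition fclass :: "real \<Rightarrow> (real \<Rightarrow> real) \<Rightarrow> (real \<Rightarrow> real) set" where
  "fclass p w = {f. f \<in> borel_measurable (lebesgue_on {0<..}) \<and> (\<forall>x>0. 0 \<le> f x)
                    \<and> 0 < fnorm p w f \<and> fnorm p w f < \<infinity>}"

definition aclass :: "real \<Rightarrow> (nat \<Rightarrow> real) \<Rightarrow> (nat \<Rightarrow> real) set" where
  "aclass q w = {a. (\<forall>n\<ge>1. 0 \<le> a n) \<and> 0 < anorm q w a \<and> anorm q w a < \<infinity>}"

end

(* Substituting y = U(x) powr \<delta> turns the kernel into h(y v_n) with v_n = V_n - \<beta>, so that the integral weight equals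
   k(\<sigma>) v_n powr (- \<sigma>) exactly. The summation weight is strictly smaller than its integral analogue: on the interval
   of radius \<nu>_(n+1)/2 around v_n a strictly decreasing, midpoint log-convex function g has mean larger than g(v_n)
   (Hermite-Hadamard), and since \<nu> decreases and \<beta> <= \<nu>_1/2 these intervals fit disjointly into (0, \<infinity>). With Jensen's inequality for
   t powr p this gives the second inequality; the reverse Hoelder inequality and its equality case
   (a = w J powr (p - 1), f = w H powr (q - 1)) transfer any constant between the three inequalities.
   Optimality is tested in the third one with a_n = \<nu>_(n+1) v_n powr (\<sigma> - e - 1) as e tends to 0: both sides then grow
   like 1/e, with ratio governed by k(\<sigma> - e), which converges to k(\<sigma>). *)
theory Submission
  imports Defs
begin

text \<open>Since p < 0, lower bounds come from upper ones: sums and integrals are estimated from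
  above, and the outer root 1/p reverses the result. The price is paid at 0 and \<infinity>:
  negative powers exchange them, and the convention 0 * \<infinity> = 0 breaks the algebra of
  powers, so each equality case must first exclude such values or confine them to a null set. The
  kernel is of order t powr (- \<gamma>) at 0, so \<gamma> < \<sigma> makes k(\<sigma>) finite. From
  \<sigma> <= 1 the factor t powr (\<sigma> - 1) is decreasing, and \<gamma> < 1 makes t powr
  \<gamma> concave; both feed the log-convexity. Testing the third inequality leaves only a sequence
  to choose and asks only for an upper bound of its inner sum. The summation weight at \<sigma> - e
  gives one, but its integral diverges at infinity, so a second bound with faster decay is needed
  there. Constants range over [0,\<infinity>]. The transfers from the first inequality to the other
  two need C < \<infinity>, and it is optimality that excludes C = \<infinity>; hence the
  equivalences for all C come last.\<close>

section \<open>Powers on the extended half line and the reverse Hoelder inequality\<close>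

lemma ennpowr_0_pos [simp]: "0 < r \<Longrightarrow> ennpowr 0 r = 0"
  and ennpowr_0_neg [simp]: "r < 0 \<Longrightarrow> ennpowr 0 r = top"
  and ennpowr_top_pos [simp]: "0 < r \<Longrightarrow> ennpowr top r = top"
  and ennpowr_top_neg [simp]: "r < 0 \<Longrightarrow> ennpowr top r = 0"
  by (auto simp: ennpowr_def)

lemma ennpowr_ennreal: "0 < x \<Longrightarrow> ennpowr (ennreal x) r = ennreal (x powr r)"
  by (auto simp: ennpowr_def ennreal_eq_0_iff)

lemma ennreal_pos_cases:
  obtains "x = 0" | "x = \<infinity>" | r where "0 < r" "x = ennreal r"
  by (cases x rule: ennreal_cases) (force simp: ennreal_0[symmetric] less_le simp del: ennreal_0)+

lemma ennpowr_1 [simp]: "ennpowr x 1 = x"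
  by (cases x rule: ennreal_pos_cases) (auto simp: ennpowr_ennreal)

lemma ennpowr_ennpowr:
  assumes "r \<noteq> 0" "s \<noteq> 0" shows "ennpowr (ennpowr x r) s = ennpowr x (r * s)"
proof (cases x rule: ennreal_pos_cases)
  case 1 then show ?thesis using assms
    by (cases "r < 0"; cases "s < 0") (auto simp: not_less order_le_less mult_pos_neg mult_neg_pos mult_neg_neg)
next
  case 2 then show ?thesis using assms
    by (cases "r < 0"; cases "s < 0") (auto simp: not_less order_le_less mult_pos_neg mult_neg_pos mult_neg_neg)
next
  case (3 t) then show ?thesis by (simp add: ennpowr_ennreal powr_powr)
qed

lemma ennpowr_cmult: "0 < c \<Longrightarrow> ennpowr (ennreal c * x) r = ennreal (c powr r) * ennpowr x r"
proof (cases x rule: ennreal_pos_cases)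
  case 1 assume "0 < c" then show ?thesis using 1
    by (cases r "0::real" rule: linorder_cases) (auto simp: ennpowr_def ennreal_mult_eq_top_iff ennreal_mult_top)
next
  case 2 assume "0 < c" then show ?thesis using 2
    by (cases r "0::real" rule: linorder_cases) (auto simp: ennpowr_def ennreal_mult_eq_top_iff ennreal_mult_top)
next
  case (3 t) assume "0 < c" then show ?thesis using 3
    by (simp add: ennpowr_ennreal powr_mult ennreal_mult'[symmetric])
qed

lemma ennpowr_strict_mono:
  assumes "0 < r" "x < y" shows "ennpowr x r < ennpowr y r"
  using assms
  by (cases x rule: ennreal_pos_cases; cases y rule: ennreal_pos_cases)
     (auto simp: ennpowr_ennreal ennreal_less_iff powr_less_mono2)

lemma ennpowr_strict_antimono:
  assumes "r < 0" "x < y" shows "ennpowr y r < ennpowr x r"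
  using assms
  by (cases x rule: ennreal_pos_cases; cases y rule: ennreal_pos_cases)
     (auto simp: ennpowr_ennreal ennreal_less_iff powr_less_mono2_neg)

lemma ennpowr_mono: "0 < r \<Longrightarrow> x \<le> y \<Longrightarrow> ennpowr x r \<le> ennpowr y r"
  using ennpowr_strict_mono[of r x y] by (auto simp: order_le_less)

lemma ennpowr_antimono: "r < 0 \<Longrightarrow> x \<le> y \<Longrightarrow> ennpowr y r \<le> ennpowr x r"
  using ennpowr_strict_antimono[of r x y] by (auto simp: order_le_less)

lemma ennpowr_add:
  assumes "0 < x" "x < \<infinity>" shows "ennpowr x (r + s) = ennpowr x r * ennpowr x s"
  using assms by (cases x rule: ennreal_pos_cases) (auto simp: ennpowr_ennreal powr_add ennreal_mult)

lemma ennpowr_pos_finite: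
  assumes "0 < x" "x < \<infinity>" shows "0 < ennpowr x r" "ennpowr x r < \<infinity>"
  using assms by (cases x rule: ennreal_pos_cases; simp add: ennpowr_ennreal)+

lemma ennpowr_pos_finite_iff:
  assumes "r \<noteq> 0" shows "0 < ennpowr x r \<and> ennpowr x r < \<infinity> \<longleftrightarrow> 0 < x \<and> x < \<infinity>"
  using assms
  by (cases x rule: ennreal_pos_cases; cases r "0::real" rule: linorder_cases) (auto simp: ennpowr_ennreal)

lemma measurable_ennpowr [measurable (raw)]:
  assumes [measurable]: "f \<in> borel_measurable M"
  shows "(\<lambda>x. ennpowr (f x) r) \<in> borel_measurable M"
  unfolding ennpowr_def by measurable

section \<open>Reverse Young and Hoelder inequalities for a negative exponent\<close>

lemma powr_sum_eq_1:
  fixes p q :: real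
  assumes "p < 0" "1 / p + 1 / q = 1"
  shows "0 < q" "q < 1" "(p - 1) * q = p" "(q - 1) * p = q" "q / p = q - 1" "p / q = p - 1"
proof -
  have q0: "q \<noteq> 0" using assms by (auto simp: field_simps)
  have e: "q + p = p * q" using assms q0 by (simp add: field_simps)
  then show *: "(p - 1) * q = p" "(q - 1) * p = q" by (simp_all add: algebra_simps)
  have q: "q = p / (p - 1)" using * assms by (simp add: field_simps)
  show "0 < q" "q < 1" using assms unfolding q by (simp_all add: divide_simps)
  show "q / p = q - 1" using * assms by (simp add: field_simps)
  show "p / q = p - 1" using * q0 by (simp add: field_simps)
qed

text \<open>The term with the negative coefficient 1/p stands on the right with its sign changed, so
  no subtraction occurs in [0,\<infinity>]. For x = 0 that term is infinite, which covers the
  degenerate cases as well.\<close>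

lemma rev_Youngs_inequality:
  assumes p: "p < 0" "1 / p + 1 / q = 1"
  shows "ennreal (1 / q) * ennpowr y q \<le> x * y + ennreal (- 1 / p) * ennpowr x p"
proof -
  note pq = powr_sum_eq_1[OF p]
  show ?thesis
  proof (cases x rule: ennreal_pos_cases; cases y rule: ennreal_pos_cases)
    fix s t assume *: "0 < s" "x = ennreal s" "0 < t" "y = ennreal t"
    (* Weighted AM-GM for s t and s powr p, since (1 - q) p = - q. *)
    have "(s * t) powr q * (s powr p) powr (1 - q) \<le> q * (s * t) + (1 - q) * s powr p"
      using Youngs_inequality_0[of q "1 - q" "s * t" "s powr p"] pq * by simp
    moreover have "(s powr p) powr (1 - q) = s powr (- q)"
      using pq by (simp add: powr_powr algebra_simps)
    ultimately have "t powr q \<le> q * (s * t) + (1 - q) * s powr p"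
      using * by (simp add: powr_mult powr_minus field_simps)
    then have "1 / q * t powr q \<le> s * t + ((1 - q) / q) * s powr p"
      using pq(1) by (simp add: field_simps)
    also have "(1 - q) / q = - 1 / p" using pq p by (simp add: field_simps)
    finally have "1 / q * t powr q \<le> s * t + - 1 / p * s powr p" .
    moreover have "0 \<le> - 1 / p * s powr p" "0 \<le> - 1 / p"
      using p by (simp_all add: divide_nonneg_neg)
    ultimately have "ennreal (1 / q * t powr q) \<le> ennreal (s * t) + ennreal (- 1 / p * s powr p)"
      using * by (subst ennreal_plus[symmetric]) (auto intro!: ennreal_leI)
    moreover have "ennreal (- 1 / p * s powr p) = ennreal (- 1 / p) * ennreal (s powr p)"
      using \<open>0 \<le> - 1 / p\<close> by (rule ennreal_mult) simp
    ultimately show ?thesis using * pq(1)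
      by (simp add: ennpowr_ennreal ennreal_mult'[symmetric])
  qed (use pq p in \<open>auto simp: ennreal_mult_top ennreal_top_mult divide_nonpos_neg ennreal_mult_eq_top_iff\<close>)
qed

text \<open>Young's inequality is integrated with G scaled by a free factor l, and l is optimised
  afterwards. The case ?A = 0 makes the left side infinite and has to be refuted, not just
  estimated.\<close>

lemma rev_holder:
  assumes p: "p < 0" "1 / p + 1 / q = 1"
    and [measurable]: "F \<in> borel_measurable M" "G \<in> borel_measurable M"
  shows "ennpowr (\<integral>\<^sup>+x. ennpowr (F x) p \<partial>M) (1 / p) * ennpowr (\<integral>\<^sup>+x. ennpowr (G x) q \<partial>M) (1 / q)
     \<le> (\<integral>\<^sup>+x. F x * G x \<partial>M)" (is "ennpowr ?A _ * ennpowr ?B _ \<le> ?J")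
proof -
  note pq = powr_sum_eq_1[OF p]
  have p': "0 < - (1 / p)" using p by simp
  have Y: "ennreal (1 / q * l powr q) * ?B \<le> ennreal l * ?J + ennreal (- (1 / p)) * ?A" if l: "0 < l" for l
  proof -
    have "ennreal (1 / q * l powr q) * ?B = (\<integral>\<^sup>+x. ennreal (1 / q) * ennpowr (ennreal l * G x) q \<partial>M)"
      using l pq by (simp add: ennpowr_cmult nn_integral_cmult ennreal_mult mult.assoc del: times_divide_eq_left)
    also have "\<dots> \<le> (\<integral>\<^sup>+x. ennreal l * (F x * G x) + ennreal (- 1 / p) * ennpowr (F x) p \<partial>M)"
      using rev_Youngs_inequality[OF p, of "ennreal l * G x" "F x" for x]
      by (intro nn_integral_mono) (simp add: mult_ac)
    also have "\<dots> = ennreal l * ?J + ennreal (- (1 / p)) * ?A"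
      by (simp add: nn_integral_add nn_integral_cmult)
    finally show ?thesis .
  qed
  show ?thesis
  proof (cases "?A = \<infinity> \<or> ?B = 0 \<or> ?J = \<infinity>")
    case True then show ?thesis using p pq by auto
  next
    case False
    then have AB: "?A \<noteq> \<infinity>" "?B \<noteq> 0" "?J \<noteq> \<infinity>" by auto
    have "?B \<noteq> \<infinity>"
      using Y[of 1] AB pq by (auto simp: top_unique ennreal_mult_top ennreal_mult_eq_top_iff)
    with AB obtain b where b: "0 < b" "?B = ennreal b" by (cases ?B rule: ennreal_pos_cases) auto
    obtain j where j: "0 \<le> j" "?J = ennreal j" using AB by (cases ?J rule: ennreal_cases) auto
    have "?A \<noteq> 0"
    proof
      assume "?A = 0"
      then have *: "1 / q * l powr q * b \<le> l * j" if "0 < l" for l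
        using Y[OF that] that b j pq by (simp add: ennreal_mult'[symmetric])
      have j0: "0 < j" using *[of 1] b pq j by (smt (verit) divide_pos_pos mult_pos_pos powr_one_eq_one mult_1)
      \<comment> \<open>As q < 1, l powr q dominates l near 0. At this l the left side of the bound
        is exactly 2 * l * j.\<close>
      define l where "l = (b / (2 * q * j)) powr (1 / (1 - q))"
      have l: "0 < l" using b j0 pq by (auto simp: l_def)
      have "l powr (1 - q) = b / (2 * q * j)" using b j0 pq by (simp add: l_def powr_powr)
      then have "2 * q * j * l powr (1 - q) = b" using j0 pq by (simp add: field_simps)
      then have "1 / q * l powr q * b = 2 * j * (l powr (1 - q) * l powr q)" using pq by (auto simp: field_simps)
      also have "l powr (1 - q) * l powr q = l" using l by (simp flip: powr_add)
      finally show False using *[OF l] l j0 by (simp add: field_simps)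
    qed
    then obtain a where a: "0 < a" "?A = ennreal a" using AB by (cases ?A rule: ennreal_pos_cases) auto
    \<comment> \<open>The optimal scale: it makes l powr q * b = a, so the terms with 1/q and 1/p
      add up to a.\<close>
    define l where "l = (a / b) powr (1 / q)"
    have l: "0 < l" "l powr q = a / b" using a b pq by (auto simp: l_def powr_powr)
    define r where "r = - (1 / p)"
    have "ennreal (1 / q * l powr q * b) \<le> ennreal (l * j + r * a)"
      using Y[OF l(1)] l(1) p'[folded r_def] a b j pq(1)
      by (simp add: ennreal_mult ennreal_plus r_def[symmetric] del: times_divide_eq_left)
    then have "1 / q * l powr q * b \<le> l * j + - (1 / p) * a"
      using l a j p'[folded r_def] unfolding r_def[symmetric] by (subst (asm) ennreal_le_iff) auto
    then have "a * (1 / p + 1 / q) \<le> l * j" using l b by (simp add: field_simps)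
    then have "a \<le> l * j" using p by simp
    then have "a / l \<le> j" using l by (simp add: field_simps)
    moreover have "a / l = a powr (1 - 1 / q) * b powr (1 / q)"
      using a b by (simp add: l_def powr_divide powr_diff field_simps)
    moreover have "1 - 1 / q = 1 / p" using p by simp
    ultimately show ?thesis using a b j by (simp add: ennpowr_ennreal ennreal_mult'[symmetric])
  qed
qed

text \<open>The roots of the weights are absorbed into F and G; the condition on w1 and w2 says that
  they cancel in the product.\<close>

lemma rev_holder_weighted:
  fixes w1 w2 :: "'a \<Rightarrow> real"
  assumes p: "p < 0" "1 / p + 1 / q = 1"
    and [measurable]: "F \<in> borel_measurable M" "G \<in> borel_measurable M"
      "w1 \<in> borel_measurable M" "w2 \<in> borel_measurable M"
    and pos: "\<And>x. x \<in> space M \<Longrightarrow> 0 < w1 x" "\<And>x. x \<in> space M \<Longrightarrow> 0 < w2 x"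
    and w: "\<And>x. x \<in> space M \<Longrightarrow> w1 x powr (1 / p) * w2 x powr (1 / q) = 1"
  shows "ennpowr (\<integral>\<^sup>+x. ennreal (w1 x) * ennpowr (F x) p \<partial>M) (1 / p)
        * ennpowr (\<integral>\<^sup>+x. ennreal (w2 x) * ennpowr (G x) q \<partial>M) (1 / q)
     \<le> (\<integral>\<^sup>+x. F x * G x \<partial>M)"
proof -
  have pq: "0 < q" using powr_sum_eq_1[OF p] by simp
  let ?F = "\<lambda>x. ennreal (w1 x powr (1 / p)) * F x" and ?G = "\<lambda>x. ennreal (w2 x powr (1 / q)) * G x"
  have "(\<integral>\<^sup>+x. ennpowr (?F x) p \<partial>M) = (\<integral>\<^sup>+x. ennreal (w1 x) * ennpowr (F x) p \<partial>M)"
    using pos p by (intro nn_integral_cong) (simp add: ennpowr_cmult less_imp_neq[symmetric] powr_powr abs_of_pos)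
  moreover have "(\<integral>\<^sup>+x. ennpowr (?G x) q \<partial>M) = (\<integral>\<^sup>+x. ennreal (w2 x) * ennpowr (G x) q \<partial>M)"
    using pos pq by (intro nn_integral_cong) (simp add: ennpowr_cmult less_imp_neq[symmetric] powr_powr abs_of_pos)
  moreover have "(\<integral>\<^sup>+x. ?F x * ?G x \<partial>M) = (\<integral>\<^sup>+x. F x * G x \<partial>M)"
  proof (intro nn_integral_cong)
    fix x assume "x \<in> space M"
    have "?F x * ?G x = ennreal (w1 x powr (1 / p) * w2 x powr (1 / q)) * (F x * G x)"
      by (simp add: ennreal_mult mult_ac)
    then show "?F x * ?G x = F x * G x" using w[OF \<open>x \<in> space M\<close>] by simp
  qed
  ultimately show ?thesis using rev_holder[OF p, of ?F M ?G] by simp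
qed

section \<open>Substitution on the half line and the closed form of the constant\<close>

lemma has_pos_derivative_imp_mono:
  fixes W :: "real \<Rightarrow> real"
  assumes deriv: "\<And>x. 0 < x \<Longrightarrow> (W has_real_derivative w x) (at x)"
    and nn: "\<And>x. 0 < x \<Longrightarrow> 0 \<le> w x" and "0 < a" "a \<le> b"
  shows "W a \<le> W b"
  by (rule DERIV_nonneg_imp_nondecreasing[OF \<open>a \<le> b\<close>]) (meson assms less_le_trans)

lemma image_greaterThan_0_eq_UN:
  fixes W :: "real \<Rightarrow> real"
  assumes deriv: "\<And>x. 0 < x \<Longrightarrow> (W has_real_derivative w x) (at x)"
    and nn: "\<And>x. 0 < x \<Longrightarrow> 0 \<le> w x"
  shows "W ` {0<..} = (\<Union>n. {W (1 / real (Suc n))..W (real (Suc n))})"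
proof safe
  fix x :: real assume x: "0 < x"
  obtain n1 where n1: "x < real n1" using reals_Archimedean2 by blast
  obtain n2 where n2: "1 / x < real n2" using reals_Archimedean2 by blast
  define n where "n = max n1 n2"
  have "x \<le> real (Suc n)" "1 / x \<le> real (Suc n)" using n1 n2 by (auto simp: n_def)
  then have "1 / real (Suc n) \<le> x" using x by (simp add: field_simps)
  then have "W x \<in> {W (1 / real (Suc n))..W (real (Suc n))}"
    using has_pos_derivative_imp_mono[OF deriv nn] x \<open>x \<le> real (Suc n)\<close> by auto
  then show "W x \<in> (\<Union>n. {W (1 / real (Suc n))..W (real (Suc n))})" by blast
next
  fix y n assume y: "y \<in> {W (1 / real (Suc n))..W (real (Suc n))}"
  have pos: "0 < x" if "1 / real (Suc n) \<le> x" for x using that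
    by (smt (verit) divide_pos_pos of_nat_0_less_iff zero_less_Suc)
  have "1 / real (Suc n) \<le> 1" "1 \<le> real (Suc n)" by (auto simp: divide_simps)
  then have le: "1 / real (Suc n) \<le> real (Suc n)" by linarith
  have "\<exists>x\<ge>1 / real (Suc n). x \<le> real (Suc n) \<and> W x = y"
    by (rule IVT) (use y pos deriv le in \<open>auto intro!: DERIV_isCont simp del: of_nat_Suc\<close>)
  then show "y \<in> W ` {0<..}" using pos by auto
qed

text \<open>The half line is exhausted by the intervals [1/(n+1), n+1]: the compact substitution
  rule applies to each, and monotone convergence does the rest. No limits of W at 0 or infinity
  enter, only its image.\<close>

lemma nn_integral_substitution_halfline_mono:
  fixes W w G :: "real \<Rightarrow> real"
  assumes deriv: "\<And>x. 0 < x \<Longrightarrow> (W has_real_derivative w x) (at x)"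
    and nn: "\<And>x. 0 < x \<Longrightarrow> 0 \<le> w x" and cont: "continuous_on {0<..} w"
    and [measurable]: "G \<in> borel_measurable borel"
  shows "(\<integral>\<^sup>+x\<in>{0<..}. ennreal (G (W x) * w x) \<partial>lborel) = (\<integral>\<^sup>+y\<in>W ` {0<..}. ennreal (G y) \<partial>lborel)"
proof -
  let ?I = "\<lambda>n. {1 / real (Suc n)..real (Suc n)}"
  let ?J = "\<lambda>n. {W (1 / real (Suc n))..W (real (Suc n))}"
  note mono = has_pos_derivative_imp_mono[OF deriv nn]
  have pos: "0 < x" if "x \<in> ?I n" for x n using that
    by (smt (verit) atLeastAtMost_iff divide_pos_pos of_nat_0_less_iff zero_less_Suc)
  have UI: "{0<..} = (\<Union>n. ?I n)"
    using image_greaterThan_0_eq_UN[of "\<lambda>x. x" "\<lambda>_. 1"] by simp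
  have UJ: "W ` {0<..} = (\<Union>n. ?J n)" using deriv nn by (rule image_greaterThan_0_eq_UN)
  have incI: "incseq (\<lambda>n. ?I n)" by (auto simp: incseq_def frac_le intro: order_trans)
  have incJ: "incseq (\<lambda>n. ?J n)"
  proof (rule incseq_SucI)
    fix n
    have "W (1 / real (Suc (Suc n))) \<le> W (1 / real (Suc n))" "W (real (Suc n)) \<le> W (real (Suc (Suc n)))"
      by (intro mono; simp add: frac_le)+
    then show "?J n \<subseteq> ?J (Suc n)" by auto
  qed
  have sup: "indicator (\<Union>n. A n) x = (SUP n. indicator (A n) x :: ennreal)"
    if "incseq A" for A :: "nat \<Rightarrow> real set" and x
    using that by (intro LIMSEQ_unique[OF LIMSEQ_indicator_incseq LIMSEQ_SUP])
      (auto simp: incseq_def indicator_def le_fun_def)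
  have incF: "incseq (\<lambda>n x. c x * indicator (A n) x)" if "incseq A"
    for A :: "nat \<Rightarrow> real set" and c :: "real \<Rightarrow> ennreal"
    using that by (auto simp: incseq_def le_fun_def indicator_def)
  \<comment> \<open>Nothing is known of W and w on the negative axis; cut off there they are
    measurable and unchanged where the integrand lives.\<close>
  have W_meas: "(\<lambda>x. indicator {0<..} x *\<^sub>R W x) \<in> borel_measurable borel"
    by (intro borel_measurable_continuous_on_indicator continuous_at_imp_continuous_on)
       (auto intro!: DERIV_isCont deriv)
  have w_meas: "(\<lambda>x. indicator {0<..} x *\<^sub>R w x) \<in> borel_measurable borel"
    by (intro borel_measurable_continuous_on_indicator cont) auto
  have meas: "(\<lambda>x. ennreal (G (W x) * w x) * indicator (?I n) x) \<in> borel_measurable lborel" for n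
  proof -
    have eq: "ennreal (G (W x) * w x) * indicator (?I n) x
      = ennreal (G (indicator {0<..} x *\<^sub>R W x) * (indicator {0<..} x *\<^sub>R w x)) * indicator (?I n) x" for x
      using pos[of x n] by (auto simp: indicator_def)
    show ?thesis unfolding eq using W_meas w_meas by measurable
  qed
  have "(\<integral>\<^sup>+x\<in>{0<..}. ennreal (G (W x) * w x) \<partial>lborel)
      = (\<integral>\<^sup>+x. (SUP n. ennreal (G (W x) * w x) * indicator (?I n) x) \<partial>lborel)"
    unfolding UI sup[OF incI] by (simp add: SUP_mult_left_ennreal)
  also have "\<dots> = (SUP n. \<integral>\<^sup>+x. ennreal (G (W x) * w x) * indicator (?I n) x \<partial>lborel)"
    by (intro nn_integral_monotone_convergence_SUP incF incI meas)
  also have "\<dots> = (SUP n. \<integral>\<^sup>+x. ennreal (G x) * indicator (?J n) x \<partial>lborel)"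
  proof (intro SUP_cong refl)
    fix n
    show "(\<integral>\<^sup>+x. ennreal (G (W x) * w x) * indicator (?I n) x \<partial>lborel)
        = (\<integral>\<^sup>+x. ennreal (G x) * indicator (?J n) x \<partial>lborel)"
    proof -
      have 1: "1 / real (Suc n) \<le> 1" "1 \<le> real (Suc n)" by (auto simp: divide_simps)
      have "(\<integral>\<^sup>+x. ennreal (G x * indicator (?J n) x) \<partial>lborel)
          = (\<integral>\<^sup>+x. ennreal (G (W x) * w x * indicator (?I n) x) \<partial>lborel)"
      proof (rule nn_integral_substitution)
        show "set_borel_measurable borel (?J n) G" by (simp add: set_borel_measurable_def)
        show "continuous_on (?I n) w" using pos by (intro continuous_on_subset[OF cont]) auto
        show "(W has_real_derivative w x) (at x)" "0 \<le> w x" if "x \<in> ?I n" for x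
          using pos[OF that] deriv nn by auto
      qed (use 1 in linarith)
      then show ?thesis by (simp only: nn_integral_set_ennreal)
    qed
  qed
  also have "\<dots> = (\<integral>\<^sup>+x. (SUP n. ennreal (G x) * indicator (?J n) x) \<partial>lborel)"
    by (intro nn_integral_monotone_convergence_SUP[symmetric] incF incJ) measurable
  also have "\<dots> = (\<integral>\<^sup>+y\<in>W ` {0<..}. ennreal (G y) \<partial>lborel)"
  proof (intro nn_integral_cong)
    fix y
    have "indicator (W ` {0<..}) y = (SUP n. indicator (?J n) y :: ennreal)"
      unfolding UJ by (rule sup[OF incJ])
    then show "(SUP n. ennreal (G y) * indicator (?J n) y) = ennreal (G y) * indicator (W ` {0<..}) y"
      by (simp only: SUP_mult_left_ennreal)
  qed
  finally show ?thesis .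
qed

text \<open>The sign e allows U powr \<delta> to be substituted for both values of \<delta>; a
  reflection at 0 reduces the decreasing case to the increasing one.\<close>

lemma nn_integral_substitution_halfline:
  fixes W w G :: "real \<Rightarrow> real"
  assumes deriv: "\<And>x. 0 < x \<Longrightarrow> (W has_real_derivative e * w x) (at x)" and e: "e \<in> {-1, 1}"
    and nn: "\<And>x. 0 < x \<Longrightarrow> 0 \<le> w x" and cont: "continuous_on {0<..} w"
    and G [measurable]: "G \<in> borel_measurable borel"
    and image: "W ` {0<..} = {0<..}"
  shows "(\<integral>\<^sup>+x\<in>{0<..}. ennreal (G (W x) * w x) \<partial>lborel) = (\<integral>\<^sup>+y\<in>{0<..}. ennreal (G y) \<partial>lborel)"
proof (cases "e = 1")
  case True
  then show ?thesis using nn_integral_substitution_halfline_mono[of W w G] assms by simp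
next
  case False
  then have e: "e = -1" using e by simp
  have im: "(\<lambda>x. - W x) ` {0<..} = {..<0}"
    using image by (subst image_image[of uminus W, symmetric]) simp
  have "((\<lambda>x. - W x) has_real_derivative w x) (at x)" if "0 < x" for x
    using DERIV_minus[OF deriv[OF that]] by (simp add: e)
  from nn_integral_substitution_halfline_mono[OF this nn cont, of "\<lambda>y. G (- y)"]
  have "(\<integral>\<^sup>+x\<in>{0<..}. ennreal (G (W x) * w x) \<partial>lborel) = (\<integral>\<^sup>+y\<in>{..<0}. ennreal (G (- y)) \<partial>lborel)"
    unfolding im by simp
  also have "\<dots> = (\<integral>\<^sup>+y\<in>{0<..}. ennreal (G y) \<partial>lborel)"
    by (subst nn_integral_real_affine[where t = 0 and c = "- 1"])
       (auto intro!: nn_integral_cong simp: indicator_def)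
  finally show ?thesis .
qed

lemma image_powr_halfline:
  fixes c r :: real
  assumes "0 < c" "r \<noteq> 0" shows "(\<lambda>t. c * t powr r) ` {0<..} = {0<..}"
proof safe
  fix y :: real assume "0 < y"
  then have "y = c * ((y / c) powr (1 / r)) powr r" using assms by (simp add: powr_powr)
  then show "y \<in> (\<lambda>t. c * t powr r) ` {0<..}" using assms \<open>0 < y\<close>
    by (intro image_eqI[of _ _ "(y / c) powr (1 / r)"]) auto
qed (use assms in auto)

section \<open>Gamma integrals and the Hurwitz zeta form of k(s)\<close>

lemma nn_integral_exp_powr:
  fixes c g s :: real
  assumes c: "0 < c" and g: "0 < g" and s: "0 < s"
  shows "(\<integral>\<^sup>+t\<in>{0<..}. ennreal (exp (- (c * t powr g)) * t powr (s - 1)) \<partial>lborel)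
       = ennreal (Gamma (s / g) / g * c powr (- (s / g)))"
proof -
  \<comment> \<open>What remains of the Jacobian and the powers of c when y = c * t powr g turns the
    integral into that of Gamma (s / g).\<close>
  define a where "a = c powr (- (s / g)) / g"
  let ?G = "\<lambda>y::real. a * (y powr (s / g - 1) / exp y)"
  have d: "((\<lambda>t. c * t powr g) has_real_derivative 1 * (c * g * t powr (g - 1))) (at t)" if "0 < t" for t
    using that by (auto intro!: derivative_eq_intros)
  have "(\<integral>\<^sup>+t\<in>{0<..}. ennreal (exp (- (c * t powr g)) * t powr (s - 1)) \<partial>lborel)
      = (\<integral>\<^sup>+t\<in>{0<..}. ennreal (?G (c * t powr g) * (c * g * t powr (g - 1))) \<partial>lborel)"
  proof (intro nn_integral_cong)
    fix t :: real
    have "a * ((c * t powr g) powr (s / g - 1)) * (c * g * t powr (g - 1)) = t powr (s - 1)" if t: "0 < t"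
    proof -
      have "(c * t powr g) powr (s / g - 1) = c powr (s / g - 1) * t powr (s - g)"
      proof -
        have "g * (s / g - 1) = s - g" using g by (simp add: field_simps)
        then show ?thesis using t c by (simp add: powr_mult powr_powr)
      qed
      then have "a * ((c * t powr g) powr (s / g - 1)) * (c * g * t powr (g - 1))
          = (c powr (- (s / g)) * c powr (s / g - 1) * c powr 1) * (t powr (s - g) * t powr (g - 1))"
        using c g by (simp add: a_def)
      also have "\<dots> = t powr (s - 1)" using t c by (simp flip: powr_add)
      finally show ?thesis .
    qed
    then show "ennreal (exp (- (c * t powr g)) * t powr (s - 1)) * indicator {0<..} t
      = ennreal (?G (c * t powr g) * (c * g * t powr (g - 1))) * indicator {0<..} t"
      by (auto simp: indicator_def exp_minus field_simps)
  qed
  also have "\<dots> = (\<integral>\<^sup>+y\<in>{0<..}. ennreal (?G y) \<partial>lborel)"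
    by (rule nn_integral_substitution_halfline[OF d])
       (use c g in \<open>auto intro!: continuous_intros image_powr_halfline\<close>)
  also have "\<dots> = (\<integral>\<^sup>+y. ennreal a * (ennreal (y powr (s / g - 1) / exp y) * indicator {0..} y) \<partial>lborel)"
    using g s by (intro nn_integral_cong_AE, intro AE_I[of _ _ "{0}"])
      (auto simp: a_def ennreal_mult'[symmetric] indicator_def)
  also have "\<dots> = ennreal a * (\<integral>\<^sup>+y\<in>{0..}. ennreal (y powr (s / g - 1) / exp y) \<partial>lborel)"
    by (rule nn_integral_cmult) measurable
  also have "(\<integral>\<^sup>+y\<in>{0..}. ennreal (y powr (s / g - 1) / exp y) \<partial>lborel) = ennreal (Gamma (s / g))"
    using nn_integral_has_integral_lebesgue'[OF _ Gamma_integral_real[of "s / g"]] s g by simp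
  finally show ?thesis using s g by (simp add: a_def ennreal_mult'[symmetric] mult_ac)
qed

lemma summable_hurwitz:
  fixes a s :: real
  assumes "0 < a" "1 < s" shows "summable (\<lambda>k. (real k + a) powr (- s))"
proof (rule summable_comparison_test'[where N = 1])
  show "summable (\<lambda>k. real k powr (- s))" using assms by (simp add: summable_real_powr_iff)
  show "norm ((real k + a) powr (- s)) \<le> real k powr (- s)" if "1 \<le> k" for k
    using that assms by (auto intro!: powr_mono2')
qed

text \<open>The kernel as a function of the single variable t = U powr \<delta> * (V_n - \<beta>),
  on which alone it depends.\<close>

definition hker :: "real \<Rightarrow> real \<Rightarrow> real \<Rightarrow> real \<Rightarrow> real" where
  "hker \<alpha> \<rho> \<gamma> t = csch (\<rho> * t powr \<gamma>) / exp (\<alpha> * t powr \<gamma>)"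

text \<open>Splitting off the leading exponential leaves the sum of a geometric series. Positivity,
  monotonicity, log-convexity and the series for k(s) are all read off this form.\<close>

lemma csch_div_exp_eq:
  "csch (\<rho> * u) / exp (\<alpha> * u) = 2 * exp (- ((\<alpha> + \<rho>) * u)) / (1 - exp (- (2 * \<rho> * u)))"
proof -
  have 1: "exp (\<rho> * u) - exp (- (\<rho> * u)) = exp (\<rho> * u) * (1 - exp (- (2 * \<rho> * u)))"
    by (simp add: algebra_simps flip: exp_add)
  have 2: "exp (- ((\<alpha> + \<rho>) * u)) = inverse (exp (\<rho> * u)) * inverse (exp (\<alpha> * u))"
    by (simp add: algebra_simps flip: exp_add exp_minus)
  show ?thesis unfolding csch_def 1 2 by (simp add: divide_inverse mult_ac)
qed

lemma hker_pos: "0 < \<rho> \<Longrightarrow> 0 < t \<Longrightarrow> 0 < hker \<alpha> \<rho> \<gamma> t"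
  by (simp add: hker_def csch_div_exp_eq)

lemma measurable_hker [measurable]: "hker \<alpha> \<rho> \<gamma> \<in> borel_measurable borel"
  unfolding hker_def csch_def by measurable

lemma kconst_eq_hker: "kconst \<alpha> \<rho> \<gamma> s = (\<integral>\<^sup>+t\<in>{0<..}. ennreal (hker \<alpha> \<rho> \<gamma> t * t powr (s - 1)) \<partial>lborel)"
  by (simp add: kconst_def hker_def nn_integral_completion)

text \<open>The geometric series in exp (- 2 * \<rho> * t powr \<gamma>) is integrated term by term,
  which nonnegativity permits, and every term is a Gamma integral. The condition \<gamma> < s puts
  the zeta exponent above 1, so this also yields that k(s) is finite.\<close>

theorem kconst_closed_form:
  assumes \<rho>: "0 < \<rho>" "- \<alpha> < \<rho>" and \<gamma>: "0 < \<gamma>" "\<gamma> < s"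
  shows "kconst \<alpha> \<rho> \<gamma> s = ennreal (2 * Gamma (s / \<gamma>) / (\<gamma> * (2 * \<rho>) powr (s / \<gamma>))
            * hurwitz_zeta (s / \<gamma>) ((\<alpha> + \<rho>) / (2 * \<rho>)))"
proof -
  \<comment> \<open>The decay rate of the k-th exponential; it equals 2 * \<rho> times (k + a) with
    a the Hurwitz parameter.\<close>
  define b where "b = (\<lambda>k. \<alpha> + \<rho> + 2 * real k * \<rho>)"
  have b: "0 < b k" for k using \<rho> by (simp add: b_def add_pos_nonneg)
  have sum: "ennreal (hker \<alpha> \<rho> \<gamma> t * t powr (s - 1))
      = (\<Sum>k. ennreal 2 * ennreal (exp (- (b k * t powr \<gamma>)) * t powr (s - 1)))" if "0 < t" for t
  proof -
    let ?u = "t powr \<gamma>"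
    have u: "0 < ?u" using that by simp
    have "(\<lambda>k. exp (- (2 * \<rho> * ?u)) ^ k) sums (1 / (1 - exp (- (2 * \<rho> * ?u))))"
      using u \<rho> by (intro geometric_sums) simp
    from sums_mult[OF this, of "2 * exp (- ((\<alpha> + \<rho>) * ?u)) * t powr (s - 1)"]
    moreover have "2 * exp (- ((\<alpha> + \<rho>) * ?u)) * t powr (s - 1) * exp (- (2 * \<rho> * ?u)) ^ k
        = 2 * (exp (- (b k * ?u)) * t powr (s - 1))" for k
    proof -
      have "exp (- (b k * ?u)) = exp (- ((\<alpha> + \<rho>) * ?u)) * exp (- (2 * \<rho> * ?u)) ^ k"
        by (simp add: b_def algebra_simps flip: exp_add exp_of_nat_mult)
      then show ?thesis by (simp only: mult_ac)
    qed
    moreover have "2 * exp (- ((\<alpha> + \<rho>) * ?u)) * t powr (s - 1) * (1 / (1 - exp (- (2 * \<rho> * ?u))))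
        = hker \<alpha> \<rho> \<gamma> t * t powr (s - 1)"
      by (simp add: hker_def csch_div_exp_eq)
    ultimately have "(\<lambda>k. 2 * (exp (- (b k * ?u)) * t powr (s - 1))) sums (hker \<alpha> \<rho> \<gamma> t * t powr (s - 1))"
      by (simp only:)
    then have "(\<Sum>k. ennreal (2 * (exp (- (b k * ?u)) * t powr (s - 1)))) = ennreal (hker \<alpha> \<rho> \<gamma> t * t powr (s - 1))"
      by (intro suminf_ennreal_eq) simp_all
    then show ?thesis by (subst (asm) ennreal_mult) (simp_all only: mult_nonneg_nonneg exp_ge_zero powr_ge_zero zero_le_numeral)
  qed
  have "kconst \<alpha> \<rho> \<gamma> s = (\<integral>\<^sup>+t. (\<Sum>k. ennreal 2 * (ennreal (exp (- (b k * t powr \<gamma>)) * t powr (s - 1)) * indicator {0<..} t)) \<partial>lborel)"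
    unfolding kconst_eq_hker
  proof (intro nn_integral_cong)
    fix t :: real
    show "ennreal (hker \<alpha> \<rho> \<gamma> t * t powr (s - 1)) * indicator {0<..} t
      = (\<Sum>k. ennreal 2 * (ennreal (exp (- (b k * t powr \<gamma>)) * t powr (s - 1)) * indicator {0<..} t))"
      by (cases "0 < t") (simp_all only: sum indicator_simps greaterThan_iff mult_1_right mult_zero_right suminf_zero simp_thms)
  qed
  also have "\<dots> = (\<Sum>k. ennreal 2 * ennreal (Gamma (s / \<gamma>) / \<gamma> * b k powr (- (s / \<gamma>))))"
    using \<gamma> b
  proof (subst nn_integral_suminf)
    show "(\<lambda>t. ennreal 2 * (ennreal (exp (- (b k * t powr \<gamma>)) * t powr (s - 1)) * indicator {0<..} t))
      \<in> borel_measurable lborel" for k by measurable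
    show "(\<Sum>k. \<integral>\<^sup>+t. ennreal 2 * (ennreal (exp (- (b k * t powr \<gamma>)) * t powr (s - 1)) * indicator {0<..} t) \<partial>lborel)
      = (\<Sum>k. ennreal 2 * ennreal (Gamma (s / \<gamma>) / \<gamma> * b k powr (- (s / \<gamma>))))"
      using \<gamma> b by (subst nn_integral_cmult, measurable) (simp only: nn_integral_exp_powr order.strict_trans[OF \<gamma>])
  qed
  also have "\<dots> = ennreal (2 * Gamma (s / \<gamma>) / (\<gamma> * (2 * \<rho>) powr (s / \<gamma>))
            * hurwitz_zeta (s / \<gamma>) ((\<alpha> + \<rho>) / (2 * \<rho>)))"
  proof -
    define a where "a = (\<alpha> + \<rho>) / (2 * \<rho>)"
    have a: "0 < a" using \<rho> by (simp add: a_def)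
    have "b k = 2 * \<rho> * (real k + a)" for k using \<rho> by (simp add: b_def a_def field_simps)
    then have bk: "2 * (Gamma (s / \<gamma>) / \<gamma> * b k powr (- (s / \<gamma>)))
      = 2 * Gamma (s / \<gamma>) / (\<gamma> * (2 * \<rho>) powr (s / \<gamma>)) * (real k + a) powr (- (s / \<gamma>))" for k
      using \<rho> a by (simp add: powr_mult powr_minus_divide)
    have "(\<lambda>k. (real k + a) powr (- (s / \<gamma>))) sums hurwitz_zeta (s / \<gamma>) a"
      using summable_hurwitz[of a "s / \<gamma>"] a \<gamma> by (simp add: hurwitz_zeta_def summable_sums)
    from sums_mult[OF this, of "2 * Gamma (s / \<gamma>) / (\<gamma> * (2 * \<rho>) powr (s / \<gamma>))"]
    have "(\<lambda>k. 2 * (Gamma (s / \<gamma>) / \<gamma> * b k powr (- (s / \<gamma>))))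
       sums (2 * Gamma (s / \<gamma>) / (\<gamma> * (2 * \<rho>) powr (s / \<gamma>)) * hurwitz_zeta (s / \<gamma>) a)"
      by (simp only: bk)
    then have "(\<Sum>k. ennreal (2 * (Gamma (s / \<gamma>) / \<gamma> * b k powr (- (s / \<gamma>)))))
       = ennreal (2 * Gamma (s / \<gamma>) / (\<gamma> * (2 * \<rho>) powr (s / \<gamma>)) * hurwitz_zeta (s / \<gamma>) a)"
      using \<gamma> by (intro suminf_ennreal_eq) simp_all
    then show ?thesis using \<gamma> unfolding a_def[symmetric]
      by (subst ennreal_mult[symmetric]) simp_all
  qed
  finally show ?thesis .
qed

section \<open>The summation weight\<close>

text \<open>The points x and 2 * m - x are paired. By AM-GM and \<open>mid\<close> the mean of their
  values is at least g m, strictly so because strict monotonicity makes the two values differ. No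
  derivatives of g are involved, and r <= m keeps the interval inside the positive axis.\<close>

lemma hermite_hadamard_strict:
  fixes g :: "real \<Rightarrow> real"
  assumes [measurable]: "g \<in> borel_measurable borel"
    and anti: "\<And>x y. 0 < x \<Longrightarrow> x < y \<Longrightarrow> g y < g x"
    and pos: "\<And>x. 0 < x \<Longrightarrow> 0 < g x"
    and mid: "\<And>x y. 0 < x \<Longrightarrow> 0 < y \<Longrightarrow> (g ((x + y) / 2))\<^sup>2 \<le> g x * g y"
    and r: "0 < r" "r \<le> m"
  shows "ennreal (2 * r * g m) < (\<integral>\<^sup>+x\<in>{m - r<..<m + r}. ennreal (g x) \<partial>lborel)" (is "_ < ?I")
proof -
  let ?S = "{m - r<..<m + r}"
  have pt: "2 * g m < g x + g (2 * m - x)" if "x \<in> ?S" "x \<noteq> m" for x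
  proof (rule power2_less_imp_less)
    have x: "0 < x" "0 < 2 * m - x" using that r by auto
    then have p: "0 < g x" "0 < g (2 * m - x)" by (auto intro: pos)
    have "x < 2 * m - x \<or> 2 * m - x < x" using \<open>x \<noteq> m\<close> by linarith
    then have "g x \<noteq> g (2 * m - x)" using anti[of x "2 * m - x"] anti[of "2 * m - x" x] x by auto
    then have "0 < (g x - g (2 * m - x))\<^sup>2" by simp
    moreover have "(g m)\<^sup>2 \<le> g x * g (2 * m - x)" using mid[OF x] by simp
    ultimately show "(2 * g m)\<^sup>2 < (g x + g (2 * m - x))\<^sup>2"
      by (simp add: power2_eq_square algebra_simps)
    show "0 \<le> g x + g (2 * m - x)" using p by simp
  qed
  have gm: "0 < g m" using r by (intro pos) auto
  have fin: "(\<integral>\<^sup>+x\<in>?S. ennreal (2 * g m) \<partial>lborel) = 2 * ennreal (2 * r * g m)"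
    using gm r by (simp add: nn_integral_cmult_indicator ennreal_mult[symmetric] ennreal_mult'[symmetric] flip: ennreal_numeral)
  \<comment> \<open>Symmetrising about m counts the integral twice; the reflection below identifies
    both halves with ?I.\<close>
  have "2 * ennreal (2 * r * g m) < (\<integral>\<^sup>+x\<in>?S. ennreal (g x + g (2 * m - x)) \<partial>lborel)"
    unfolding fin[symmetric]
  proof (rule nn_integral_less)
    show "(\<integral>\<^sup>+x\<in>?S. ennreal (2 * g m) \<partial>lborel) \<noteq> \<infinity>"
      unfolding fin using ennreal_mult_eq_top_iff by (auto simp: ennreal_mult_eq_top_iff)
    have le: "2 * g m \<le> g x + g (2 * m - x)" if "x \<in> ?S" for x
      using pt[OF that] by (cases "x = m") auto
    show "AE x in lborel. ennreal (2 * g m) * indicator ?S x \<le> ennreal (g x + g (2 * m - x)) * indicator ?S x"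
      using le by (intro AE_I2) (auto simp: indicator_def intro!: ennreal_leI)
    show "\<not> (AE x in lborel. ennreal (g x + g (2 * m - x)) * indicator ?S x \<le> ennreal (2 * g m) * indicator ?S x)"
    proof
      assume "AE x in lborel. ennreal (g x + g (2 * m - x)) * indicator ?S x \<le> ennreal (2 * g m) * indicator ?S x"
      then have "AE x in lborel. x \<notin> {m<..<m + r}"
      proof eventually_elim
        fix x assume *: "ennreal (g x + g (2 * m - x)) * indicator ?S x \<le> ennreal (2 * g m) * indicator ?S x"
        show "x \<notin> {m<..<m + r}"
        proof
          assume x: "x \<in> {m<..<m + r}"
          then have "x \<in> ?S" "x \<noteq> m" using r by auto
          then show False using * pt[of x] gm by (simp add: ennreal_le_iff2)
        qed
      qed
      then have "{m<..<m + r} \<in> null_sets lborel" by (subst AE_iff_null_sets) auto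
      then show False using r by (simp add: null_sets_def)
    qed
  qed measurable
  also have "(\<integral>\<^sup>+x\<in>?S. ennreal (g x + g (2 * m - x)) \<partial>lborel)
      = (\<integral>\<^sup>+x. ennreal (g x) * indicator ?S x + ennreal (g (2 * m - x)) * indicator ?S x \<partial>lborel)"
    using pos r by (intro nn_integral_cong) (auto simp: indicator_def less_imp_le)
  also have "\<dots> = ?I + (\<integral>\<^sup>+x\<in>?S. ennreal (g (2 * m - x)) \<partial>lborel)"
    by (rule nn_integral_add) measurable
  also have "(\<integral>\<^sup>+x\<in>?S. ennreal (g (2 * m - x)) \<partial>lborel) = ?I"
    by (subst (2) nn_integral_real_affine[where t = "2 * m" and c = "- 1"])
       (auto intro!: nn_integral_cong simp: indicator_def)
  finally have "2 * ennreal (2 * r * g m) < 2 * ?I" by (simp only: mult_2)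
  then show ?thesis using mult_left_mono[of ?I "ennreal (2 * r * g m)" 2] by (auto simp: not_less[symmetric])
qed

lemma psum_Suc: "psum \<nu> (Suc n) = psum \<nu> n + \<nu> (Suc n)"
  by (simp add: psum_def)

lemma suminf_strict_mono_ennreal:
  fixes f g :: "nat \<Rightarrow> ennreal"
  assumes "\<And>n. f n \<le> g n" "f 0 < g 0" "(\<Sum>n. g n) < \<infinity>"
  shows "(\<Sum>n. f n) < (\<Sum>n. g n)"
proof -
  have split: "(\<Sum>n. f n) = f 0 + (\<Sum>n. f (Suc n))" for f :: "nat \<Rightarrow> ennreal"
    using suminf_offset[of f 1] by simp
  have "(\<Sum>n. f n) \<le> f 0 + (\<Sum>n. g (Suc n))"
    unfolding split[of f] using assms(1) by (intro add_left_mono suminf_le) auto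
  also have "\<dots> < g 0 + (\<Sum>n. g (Suc n))"
    using assms(2,3) unfolding split[of g]
    by (auto simp: add.commute[of _ "suminf _"] ennreal_add_left_cancel_less)
  finally show ?thesis by (simp add: split[of g])
qed

lemma sum_less_integral_of_log_convex:
  fixes g :: "real \<Rightarrow> real" and \<nu> :: "nat \<Rightarrow> real"
  assumes \<nu>: "\<And>n. n \<ge> 1 \<Longrightarrow> \<nu> n > 0" "\<And>n. n \<ge> 1 \<Longrightarrow> \<nu> (Suc n) \<le> \<nu> n" and \<beta>: "\<beta> \<le> \<nu> 1 / 2"
    and g [measurable]: "g \<in> borel_measurable borel"
    and anti: "\<And>x y. 0 < x \<Longrightarrow> x < y \<Longrightarrow> g y < g x"
    and pos: "\<And>x. 0 < x \<Longrightarrow> 0 < g x"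
    and mid: "\<And>x y. 0 < x \<Longrightarrow> 0 < y \<Longrightarrow> (g ((x + y) / 2))\<^sup>2 \<le> g x * g y"
    and fin: "(\<integral>\<^sup>+x\<in>{0<..}. ennreal (g x) \<partial>lborel) < \<infinity>"
  shows "(\<Sum>n. ennreal (\<nu> (Suc (Suc n)) * g (psum \<nu> (Suc n) - \<beta>))) < (\<integral>\<^sup>+x\<in>{0<..}. ennreal (g x) \<partial>lborel)"
proof -
  define v where "v n = psum \<nu> (Suc n) - \<beta>" for n
  \<comment> \<open>The interval between c n and c (Suc n) reaches \<nu> (Suc n) / 2 to the left of
    v n and \<nu> (Suc (Suc n)) / 2 to the right; as \<nu> decreases, it contains the symmetric one
    of the smaller radius. The condition on \<beta> says exactly that c 0 = \<nu> 1 / 2 - \<beta> is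
    nonnegative.\<close>
  define c where "c n = v n - \<nu> (Suc n) / 2" for n
  have cS: "c (Suc n) = v n + \<nu> (Suc (Suc n)) / 2" for n
    by (simp add: c_def v_def psum_Suc)
  have cm: "c n < c (Suc n)" for n unfolding cS using \<nu>(1)[of "Suc n"] \<nu>(1)[of "Suc (Suc n)"] by (simp add: c_def)
  have c_mono: "c m \<le> c n" if "m \<le> n" for m n
    using less_imp_le[OF cm] that by (rule lift_Suc_mono_le)
  have "0 \<le> c 0" using \<beta> by (simp add: c_def v_def psum_def)
  then have c0: "0 \<le> c n" for n using c_mono[of 0 n] by simp
  let ?A = "\<lambda>n. {c n<..<c (Suc n)}"
  have disj: "disjoint_family ?A"
    unfolding disjoint_family_on_def
  proof (intro ballI impI)
    fix m n :: nat assume "m \<noteq> n"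
    then consider "Suc m \<le> n" | "Suc n \<le> m" by linarith
    then show "?A m \<inter> ?A n = {}" by cases (use c_mono in force)+
  qed
  have step: "ennreal (\<nu> (Suc (Suc n)) * g (v n)) < (\<integral>\<^sup>+x\<in>?A n. ennreal (g x) \<partial>lborel)" for n
  proof -
    let ?r = "\<nu> (Suc (Suc n)) / 2"
    have r: "0 < ?r" "?r \<le> \<nu> (Suc n) / 2" using \<nu>(1)[of "Suc (Suc n)"] \<nu>(2)[of "Suc n"] by auto
    then have "?r \<le> v n" using c0[of n] by (simp add: c_def)
    with r(1) have "ennreal (2 * ?r * g (v n)) < (\<integral>\<^sup>+x\<in>{v n - ?r<..<v n + ?r}. ennreal (g x) \<partial>lborel)"
      by (intro hermite_hadamard_strict anti pos mid) auto
    also have "\<dots> \<le> (\<integral>\<^sup>+x\<in>?A n. ennreal (g x) \<partial>lborel)"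
      unfolding cS using r(2) by (intro nn_integral_mono) (auto simp: indicator_def c_def)
    finally show ?thesis by simp
  qed
  have S: "(\<Sum>n. \<integral>\<^sup>+x\<in>?A n. ennreal (g x) \<partial>lborel) \<le> (\<integral>\<^sup>+x\<in>{0<..}. ennreal (g x) \<partial>lborel)"
  proof -
    have "(\<Sum>n. \<integral>\<^sup>+x\<in>?A n. ennreal (g x) \<partial>lborel) = (\<integral>\<^sup>+x\<in>(\<Union>n. ?A n). ennreal (g x) \<partial>lborel)"
      by (rule nn_integral_disjoint_family[symmetric]) (use disj in auto)
    also have "\<dots> \<le> (\<integral>\<^sup>+x\<in>{0<..}. ennreal (g x) \<partial>lborel)"
      using c0 by (intro nn_integral_mono) (auto simp: indicator_def dest: le_less_trans)
    finally show ?thesis .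
  qed
  have "(\<Sum>n. ennreal (\<nu> (Suc (Suc n)) * g (v n))) < (\<Sum>n. \<integral>\<^sup>+x\<in>?A n. ennreal (g x) \<partial>lborel)"
    using step le_less_trans[OF S fin] by (intro suminf_strict_mono_ennreal) (auto simp: less_imp_le)
  with S show ?thesis by (simp add: v_def)
qed

section \<open>Monotonicity and log-convexity of the kernel\<close>

lemma csch_div_exp_strict_antimono:
  assumes "0 < \<rho>" "- \<alpha> < \<rho>" "0 < u" "u < w"
  shows "csch (\<rho> * w) / exp (\<alpha> * w) < csch (\<rho> * u) / exp (\<alpha> * u)"
  unfolding csch_div_exp_eq
proof (rule frac_less)
  show "2 * exp (- ((\<alpha> + \<rho>) * w)) < 2 * exp (- ((\<alpha> + \<rho>) * u))"
    using assms by simp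
qed (use assms in auto)

text \<open>The exponential numerators agree at the midpoint. What is left is (1 - a^2) * (1 - b^2)
  <= (1 - a * b)^2, whose two sides differ by (a - b)^2.\<close>

lemma csch_div_exp_log_convex:
  assumes "0 < \<rho>" "0 < u" "0 < w"
  shows "(csch (\<rho> * ((u + w) / 2)) / exp (\<alpha> * ((u + w) / 2)))\<^sup>2
     \<le> (csch (\<rho> * u) / exp (\<alpha> * u)) * (csch (\<rho> * w) / exp (\<alpha> * w))"
proof -
  define a b where "a = exp (- (\<rho> * u))" and "b = exp (- (\<rho> * w))"
  have ab: "0 < a" "a < 1" "0 < b" "b < 1" using assms by (auto simp: a_def b_def)
  have d: "1 - exp (- (2 * \<rho> * u)) = 1 - a\<^sup>2" "1 - exp (- (2 * \<rho> * w)) = 1 - b\<^sup>2"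
      "1 - exp (- (2 * \<rho> * ((u + w) / 2))) = 1 - a * b"
    by (simp_all add: a_def b_def power2_eq_square algebra_simps flip: exp_add)
  have n: "(exp (- ((\<alpha> + \<rho>) * ((u + w) / 2))))\<^sup>2 = exp (- ((\<alpha> + \<rho>) * u)) * exp (- ((\<alpha> + \<rho>) * w))"
    by (simp add: power2_eq_square algebra_simps flip: exp_add)
  have "a\<^sup>2 < 1" "b\<^sup>2 < 1" using ab by (auto simp: abs_square_less_1)
  then have pos: "0 < (1 - a\<^sup>2) * (1 - b\<^sup>2)" by simp
  have "(1 - a\<^sup>2) * (1 - b\<^sup>2) = (1 - a * b)\<^sup>2 - (a - b)\<^sup>2" by (simp add: power2_eq_square algebra_simps)
  then have le: "(1 - a\<^sup>2) * (1 - b\<^sup>2) \<le> (1 - a * b)\<^sup>2" by simp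
  have "(2 * exp (- ((\<alpha> + \<rho>) * ((u + w) / 2))))\<^sup>2 / (1 - a * b)\<^sup>2
     \<le> (2 * exp (- ((\<alpha> + \<rho>) * ((u + w) / 2))))\<^sup>2 / ((1 - a\<^sup>2) * (1 - b\<^sup>2))"
    using le pos by (intro divide_left_mono) (auto intro!: mult_pos_pos less_le_trans[OF pos le])
  also have "(2 * exp (- ((\<alpha> + \<rho>) * ((u + w) / 2))))\<^sup>2 = 4 * (exp (- ((\<alpha> + \<rho>) * u)) * exp (- ((\<alpha> + \<rho>) * w)))"
    by (simp only: power_mult_distrib n) simp
  finally show ?thesis unfolding csch_div_exp_eq d power_divide power_mult_distrib n by simp
qed

text \<open>Weighted AM-GM gives the tangent bound at the midpoint m; added for x and y, its linear
  terms combine because x + y = 2 * m.\<close>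

lemma powr_midpoint_concave:
  fixes x y \<gamma> :: real
  assumes "0 < x" "0 < y" "0 < \<gamma>" "\<gamma> < 1"
  shows "(x powr \<gamma> + y powr \<gamma>) / 2 \<le> ((x + y) / 2) powr \<gamma>"
proof -
  define m where "m = (x + y) / 2"
  have m: "0 < m" using assms by (simp add: m_def)
  have "z powr \<gamma> \<le> (\<gamma> * (z / m) + (1 - \<gamma>)) * m powr \<gamma>" if "0 < z" for z
    using Youngs_inequality_0[of \<gamma> "1 - \<gamma>" "z / m" 1] m that assms
    by (simp add: powr_divide pos_divide_le_eq)
  from this[OF assms(1)] this[OF assms(2)]
  have "x powr \<gamma> + y powr \<gamma> \<le> (\<gamma> * ((x + y) / m) + 2 * (1 - \<gamma>)) * m powr \<gamma>"
    by (simp add: algebra_simps add_divide_distrib)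
  also have "x + y = 2 * m" by (simp add: m_def)
  also have "2 * m / m = 2" using m by simp
  finally show ?thesis by (simp add: m_def[symmetric] algebra_simps)
qed

lemma hker_strict_antimono:
  assumes "0 < \<rho>" "- \<alpha> < \<rho>" "0 < \<gamma>" "0 < x" "x < y"
  shows "hker \<alpha> \<rho> \<gamma> y < hker \<alpha> \<rho> \<gamma> x"
  unfolding hker_def using assms by (intro csch_div_exp_strict_antimono) (auto intro: powr_less_mono2)

text \<open>A decreasing log-convex function composed with the concave t powr \<gamma> is again
  log-convex.\<close>

lemma hker_log_convex:
  assumes "0 < \<rho>" "- \<alpha> < \<rho>" "0 < \<gamma>" "\<gamma> < 1" "0 < x" "0 < y"
  shows "(hker \<alpha> \<rho> \<gamma> ((x + y) / 2))\<^sup>2 \<le> hker \<alpha> \<rho> \<gamma> x * hker \<alpha> \<rho> \<gamma> y"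
proof -
  let ?E = "\<lambda>u. csch (\<rho> * u) / exp (\<alpha> * u)"
  let ?u = "(x powr \<gamma> + y powr \<gamma>) / 2"
  have u: "0 < ?u" "?u \<le> ((x + y) / 2) powr \<gamma>"
    using assms powr_midpoint_concave by (auto intro!: add_pos_pos)
  have "?E (((x + y) / 2) powr \<gamma>) \<le> ?E ?u"
    using csch_div_exp_strict_antimono[OF assms(1,2) u(1), of "((x + y) / 2) powr \<gamma>"] u(2)
    by (cases "?u = ((x + y) / 2) powr \<gamma>") auto
  moreover have "0 \<le> ?E (((x + y) / 2) powr \<gamma>)"
    using hker_pos[of \<rho> "(x + y) / 2" \<alpha> \<gamma>] assms by (simp add: hker_def)
  ultimately have "(?E (((x + y) / 2) powr \<gamma>))\<^sup>2 \<le> (?E ?u)\<^sup>2" by (intro power_mono) auto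
  also have "\<dots> \<le> ?E (x powr \<gamma>) * ?E (y powr \<gamma>)"
    using assms by (intro csch_div_exp_log_convex) auto
  finally show ?thesis by (simp add: hker_def)
qed

section \<open>Scaling, the summation weight, decay, and continuity of k(s)\<close>

lemma nn_integral_hker_scale:
  assumes "0 < u"
  shows "(\<integral>\<^sup>+t\<in>{0<..}. ennreal (hker \<alpha> \<rho> \<gamma> (u * t) * t powr (s - 1)) \<partial>lborel) = ennreal (u powr (- s)) * kconst \<alpha> \<rho> \<gamma> s"
proof -
  let ?G = "\<lambda>y. u powr (- s) * (hker \<alpha> \<rho> \<gamma> y * y powr (s - 1))"
  have "?G (u * t) * u = hker \<alpha> \<rho> \<gamma> (u * t) * t powr (s - 1)" if "0 < t" for t
  proof -
    have "?G (u * t) * u = (u powr (- s) * u powr (s - 1) * u powr 1) * hker \<alpha> \<rho> \<gamma> (u * t) * t powr (s - 1)"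
      using that assms by (simp add: powr_mult)
    also have "u powr (- s) * u powr (s - 1) * u powr 1 = 1" using assms by (simp flip: powr_add)
    finally show ?thesis by simp
  qed
  then have "(\<integral>\<^sup>+t\<in>{0<..}. ennreal (hker \<alpha> \<rho> \<gamma> (u * t) * t powr (s - 1)) \<partial>lborel)
      = (\<integral>\<^sup>+t\<in>{0<..}. ennreal (?G (u * t) * u) \<partial>lborel)"
    by (intro nn_integral_cong) (metis (lifting) greaterThan_iff indicator_simps(2) mult_zero_right)
  also have "\<dots> = (\<integral>\<^sup>+y\<in>{0<..}. ennreal (?G y) \<partial>lborel)"
    using assms image_powr_halfline[of u 1]
    by (intro nn_integral_substitution_halfline[where e = 1]) (auto intro!: derivative_eq_intros)
  also have "\<dots> = (\<integral>\<^sup>+y. ennreal (u powr (- s)) * (ennreal (hker \<alpha> \<rho> \<gamma> y * y powr (s - 1)) * indicator {0<..} y) \<partial>lborel)"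
    by (simp add: ennreal_mult' mult.assoc)
  also have "\<dots> = ennreal (u powr (- s)) * kconst \<alpha> \<rho> \<gamma> s"
    unfolding kconst_eq_hker by (rule nn_integral_cmult) measurable
  finally show ?thesis .
qed

lemma kconst_finite:
  assumes "0 < \<rho>" "- \<alpha> < \<rho>" "0 < \<gamma>" "\<gamma> < s"
  shows "kconst \<alpha> \<rho> \<gamma> s < \<infinity>"
  using kconst_closed_form[OF assms] by simp

text \<open>The comparison is applied to g t = h (u * t) * t powr (s - 1), where s <= 1 makes the
  second factor decreasing and log-convex. The exponent s is kept free because the optimality
  argument needs it at \<sigma> - e.\<close>

lemma weight_sum_less:
  fixes \<nu> :: "nat \<Rightarrow> real"
  assumes \<nu>: "\<And>n. n \<ge> 1 \<Longrightarrow> \<nu> n > 0" "\<And>n. n \<ge> 1 \<Longrightarrow> \<nu> (Suc n) \<le> \<nu> n" and \<beta>: "\<beta> \<le> \<nu> 1 / 2"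
    and h: "0 < \<rho>" "- \<alpha> < \<rho>" "0 < \<gamma>" "\<gamma> < s" "s \<le> 1" and u: "0 < u"
  shows "(\<Sum>n. ennreal (\<nu> (Suc (Suc n)) * (hker \<alpha> \<rho> \<gamma> (u * (psum \<nu> (Suc n) - \<beta>)) * (psum \<nu> (Suc n) - \<beta>) powr (s - 1))))
      < ennreal (u powr (- s)) * kconst \<alpha> \<rho> \<gamma> s"
  unfolding nn_integral_hker_scale[OF u, symmetric]
proof (rule sum_less_integral_of_log_convex[OF \<nu> \<beta>])
  let ?h = "hker \<alpha> \<rho> \<gamma>"
  have hp: "0 < ?h (u * x)" if "0 < x" for x using that u h by (intro hker_pos) auto
  show "?h (u * y) * y powr (s - 1) < ?h (u * x) * x powr (s - 1)" if "0 < x" "x < y" for x y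
  proof (rule mult_less_le_imp_less)
    show "?h (u * y) < ?h (u * x)" using that h u by (intro hker_strict_antimono) auto
    show "y powr (s - 1) \<le> x powr (s - 1)" using that h by (intro powr_mono2') auto
    show "0 \<le> ?h (u * y)" "0 < y powr (s - 1)" using hp[of y] that by auto
  qed
  show "(?h (u * ((x + y) / 2)) * ((x + y) / 2) powr (s - 1))\<^sup>2
     \<le> ?h (u * x) * x powr (s - 1) * (?h (u * y) * y powr (s - 1))" if "0 < x" "0 < y" for x y
  proof -
    have 1: "(?h (u * ((x + y) / 2)))\<^sup>2 \<le> ?h (u * x) * ?h (u * y)"
      using hker_log_convex[of \<rho> \<alpha> \<gamma> "u * x" "u * y"] h u that by (simp add: algebra_simps add_divide_distrib)
    have "0 \<le> (x - y)\<^sup>2" by simp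
    then have "x * y \<le> ((x + y) / 2)\<^sup>2" by (simp add: power2_eq_square algebra_simps)
    then have "(((x + y) / 2)\<^sup>2) powr (s - 1) \<le> (x * y) powr (s - 1)"
      using that h by (intro powr_mono2') auto
    then have "(((x + y) / 2) powr (s - 1))\<^sup>2 \<le> x powr (s - 1) * y powr (s - 1)"
      using that by (simp add: power2_eq_square powr_mult del: times_divide_eq_left times_divide_eq_right)
    from mult_mono[OF 1 this] show ?thesis
      using hp[OF that(1)] hp[OF that(2)] by (simp add: power_mult_distrib mult_ac)
  qed
  show "(\<integral>\<^sup>+x\<in>{0<..}. ennreal (?h (u * x) * x powr (s - 1)) \<partial>lborel) < \<infinity>"
    unfolding nn_integral_hker_scale[OF u] using kconst_finite[OF h(1-4)] by (simp add: ennreal_mult_less_top)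
qed (use hker_pos u h in auto)

text \<open>A Chebyshev-type bound: the kernel decreases, so its value at t times the integral of x
  powr (s - 1) over [0, t] is at most k(s). This gives decay of any order s > \<gamma> without
  estimating csch.\<close>

lemma hker_le:
  assumes h: "0 < \<rho>" "- \<alpha> < \<rho>" "0 < \<gamma>" "\<gamma> < s" and t: "0 < t"
  shows "hker \<alpha> \<rho> \<gamma> t \<le> s * enn2real (kconst \<alpha> \<rho> \<gamma> s) * t powr (- s)"
proof -
  have s: "0 < s" using h by simp
  have ht: "0 < hker \<alpha> \<rho> \<gamma> t" using hker_pos h t by auto
  have "((\<lambda>x. x powr (s - 1)) has_integral (t powr s / s)) {0..t}"
    using has_integral_powr_from_0[of "s - 1" t] s t by simp
  then have "(\<integral>\<^sup>+x\<in>{0..t}. ennreal (x powr (s - 1)) \<partial>lborel) = ennreal (t powr s / s)"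
    by (intro nn_integral_has_integral_lebesgue') auto
  then have "ennreal (hker \<alpha> \<rho> \<gamma> t * (t powr s / s)) = (\<integral>\<^sup>+x. ennreal (hker \<alpha> \<rho> \<gamma> t) * (ennreal (x powr (s - 1)) * indicator {0..t} x) \<partial>lborel)"
    using s ht by (subst nn_integral_cmult) (auto simp: ennreal_mult simp del: times_divide_eq_right)
  also have "\<dots> \<le> (\<integral>\<^sup>+x\<in>{0<..}. ennreal (hker \<alpha> \<rho> \<gamma> x * x powr (s - 1)) \<partial>lborel)"
  proof (intro nn_integral_mono)
    fix x
    show "ennreal (hker \<alpha> \<rho> \<gamma> t) * (ennreal (x powr (s - 1)) * indicator {0..t} x) \<le> ennreal (hker \<alpha> \<rho> \<gamma> x * x powr (s - 1)) * indicator {0<..} x"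
      using hker_strict_antimono[OF h(1-3), of x t] ht
      by (cases "x = t"; cases "x = 0") (auto simp: indicator_def ennreal_mult'[symmetric] less_imp_le intro!: ennreal_leI mult_right_mono)
  qed
  also have "\<dots> = ennreal (enn2real (kconst \<alpha> \<rho> \<gamma> s))"
    using kconst_finite[OF h] by (simp add: kconst_eq_hker)
  finally have "hker \<alpha> \<rho> \<gamma> t * (t powr s / s) \<le> enn2real (kconst \<alpha> \<rho> \<gamma> s)" by simp
  then show ?thesis using s t by (simp add: powr_minus field_simps)
qed

lemma kconst_tendsto:
  assumes h: "0 < \<rho>" "- \<alpha> < \<rho>" "0 < \<gamma>" "0 < \<eta>" "\<gamma> < s - \<eta>"
  shows "(\<lambda>n. kconst \<alpha> \<rho> \<gamma> (s - \<eta> / real (Suc n))) \<longlonglongrightarrow> kconst \<alpha> \<rho> \<gamma> s"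
  unfolding kconst_eq_hker
proof (rule nn_integral_dominated_convergence)
  let ?h = "hker \<alpha> \<rho> \<gamma>"
  \<comment> \<open>A power with exponent between two others lies below the larger power for x >= 1
    and below the smaller one for x < 1, hence below their sum.\<close>
  let ?w = "\<lambda>x. ennreal (?h x * x powr (s - 1)) * indicator {0<..} x + ennreal (?h x * x powr (s - \<eta> - 1)) * indicator {0<..} x"
  have "(\<integral>\<^sup>+x. ?w x \<partial>lborel) = kconst \<alpha> \<rho> \<gamma> s + kconst \<alpha> \<rho> \<gamma> (s - \<eta>)"
    unfolding kconst_eq_hker by (rule nn_integral_add) measurable
  then show "(\<integral>\<^sup>+x. ?w x \<partial>lborel) < \<infinity>" using kconst_finite[OF h(1-3)] h by simp
  show "AE x in lborel. ennreal (?h x * x powr (s - \<eta> / real (Suc n) - 1)) * indicator {0<..} x \<le> ?w x" for n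
  proof (intro AE_I2)
    fix x :: real
    have e: "0 \<le> \<eta> / real (Suc n)" "\<eta> / real (Suc n) \<le> \<eta>" using h by (auto simp: divide_simps mult_left_mono)
    have "x powr (s - \<eta> / real (Suc n) - 1) \<le> x powr (s - 1) + x powr (s - \<eta> - 1)" if "0 < x"
    proof (cases "1 \<le> x")
      case True
      then have "x powr (s - \<eta> / real (Suc n) - 1) \<le> x powr (s - 1)" using e by (intro powr_mono) auto
      then show ?thesis by (simp add: add_increasing2)
    next
      case False
      then have "x powr (s - \<eta> / real (Suc n) - 1) \<le> x powr (s - \<eta> - 1)" using e that by (intro powr_mono') auto
      then show ?thesis by (simp add: add_increasing)
    qed
    then have "?h x * x powr (s - \<eta> / real (Suc n) - 1) \<le> ?h x * x powr (s - 1) + ?h x * x powr (s - \<eta> - 1)" if "0 < x"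
      using hker_pos[OF h(1) that, of \<alpha> \<gamma>] that by (simp add: distrib_left[symmetric] mult_left_mono)
    then show "ennreal (?h x * x powr (s - \<eta> / real (Suc n) - 1)) * indicator {0<..} x \<le> ?w x"
      using hker_pos[OF h(1), of x \<alpha> \<gamma>]
      by (cases "0 < x") (auto simp: ennreal_plus[symmetric] intro!: ennreal_leI simp del: ennreal_plus)
  qed
  show "AE x in lborel. (\<lambda>n. ennreal (?h x * x powr (s - \<eta> / real (Suc n) - 1)) * indicator {0<..} x)
     \<longlonglongrightarrow> ennreal (?h x * x powr (s - 1)) * indicator {0<..} x"
  proof (intro AE_I2)
    fix x :: real
    have "(\<lambda>n. \<eta> / real (Suc n)) \<longlonglongrightarrow> 0"
      using LIMSEQ_Suc[OF lim_const_over_n[of \<eta>]] by simp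
    then have "(\<lambda>n. s - \<eta> / real (Suc n) - 1) \<longlonglongrightarrow> s - 0 - 1" by (intro tendsto_intros)
    then have *: "(\<lambda>n. s - \<eta> / real (Suc n) - 1) \<longlonglongrightarrow> s - 1" by simp
    then have "(\<lambda>n. ennreal (?h x * x powr (s - \<eta> / real (Suc n) - 1))) \<longlonglongrightarrow> ennreal (?h x * x powr (s - 1))" if "0 < x"
      using that by (intro tendsto_ennrealI tendsto_mult tendsto_const tendsto_powr *) auto
    then show "(\<lambda>n. ennreal (?h x * x powr (s - \<eta> / real (Suc n) - 1)) * indicator {0<..} x)
     \<longlonglongrightarrow> ennreal (?h x * x powr (s - 1)) * indicator {0<..} x"
      by (cases "0 < x") auto
  qed
qed measurable

section \<open>The substitution given by the primitive of the weight\<close>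

locale regular_weight =
  fixes \<mu> :: "real \<Rightarrow> real"
  assumes cont_\<mu>: "continuous_on {0<..} \<mu>" and \<mu>_pos: "\<And>x. x > 0 \<Longrightarrow> \<mu> x > 0"
    and integrable_\<mu>: "\<And>x. x > 0 \<Longrightarrow> set_integrable lborel {0<..<x} \<mu>"
    and prim_at_top: "filterlim (prim \<mu>) at_top at_top"
begin

text \<open>\<mu> may be unbounded at 0. Splitting at c > 0 leaves a continuous integrand on a
  compact interval, to which the fundamental theorem applies.\<close>

lemma prim_split:
  assumes "0 < c" "c \<le> y"
  shows "prim \<mu> y = prim \<mu> c + integral {c..y} \<mu>"
proof -
  have cont: "continuous_on {c..y} \<mu>" using assms by (intro continuous_on_subset[OF cont_\<mu>]) auto
  have i: "set_integrable lborel {c..y} \<mu>"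
    using cont borel_integrable_compact[of "{c..y}" \<mu>] by (simp add: set_integrable_def mult.commute indicator_def if_distrib cong: if_cong)
  have y: "0 < y" using assms by simp
  have "{0<..<y} = {0<..<c} \<union> {c..<y}" using assms by auto
  moreover have i': "set_integrable lborel {c..<y} \<mu>" using i by (rule set_integrable_subset) auto
  ultimately have "prim \<mu> y = prim \<mu> c + (LINT t:{c..<y}|lborel. \<mu> t)"
    unfolding prim_def using integrable_\<mu>[OF assms(1)] by (simp add: set_integral_Un disjoint_iff)
  also have "(LINT t:{c..<y}|lborel. \<mu> t) = (LINT t:{c..y}|lborel. \<mu> t)"
    unfolding set_lebesgue_integral_def
  proof (rule integral_cong_AE)
    show "(\<lambda>x. indicator {c..<y} x *\<^sub>R \<mu> x) \<in> borel_measurable lborel"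
      "(\<lambda>x. indicator {c..y} x *\<^sub>R \<mu> x) \<in> borel_measurable lborel"
      using i i' unfolding set_integrable_def by (blast dest: borel_measurable_integrable)+
    show "AE x in lborel. indicator {c..<y} x *\<^sub>R \<mu> x = indicator {c..y} x *\<^sub>R \<mu> x"
      by (rule AE_I[of _ _ "{y}"]) (auto simp: indicator_def)
  qed
  also have "\<dots> = integral {c..y} \<mu>" by (rule set_borel_integral_eq_integral(2)[OF i])
  finally show ?thesis .
qed

lemma prim_nonneg: "0 \<le> prim \<mu> x"
  unfolding prim_def set_lebesgue_integral_def
  by (rule Bochner_Integration.integral_nonneg) (simp add: indicator_def \<mu>_pos less_imp_le)

lemma prim_deriv:
  assumes "0 < x" shows "(prim \<mu> has_real_derivative \<mu> x) (at x)"
proof -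
  let ?a = "x / 2" and ?b = "x + 1"
  have "((\<lambda>y. integral {?a..y} \<mu>) has_real_derivative \<mu> x) (at x within {?a..?b})"
    using assms by (intro integral_has_real_derivative continuous_on_subset[OF cont_\<mu>]) auto
  then have "((\<lambda>y. prim \<mu> ?a + integral {?a..y} \<mu>) has_real_derivative 0 + \<mu> x) (at x within {?a..?b})"
    by (intro DERIV_add DERIV_const)
  moreover have "at x within {?a..?b} = at x" using assms by (intro at_within_interior) auto
  ultimately have "((\<lambda>y. prim \<mu> ?a + integral {?a..y} \<mu>) has_real_derivative \<mu> x) (at x)" by simp
  then show ?thesis
  proof (rule has_field_derivative_transform_within_open)
    show "prim \<mu> ?a + integral {?a..y} \<mu> = prim \<mu> y" if "y \<in> {?a<..}" for y
      using assms that by (intro prim_split[symmetric]) auto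
  qed (use assms in auto)
qed

lemma prim_strict_mono: "0 < x \<Longrightarrow> x < y \<Longrightarrow> prim \<mu> x < prim \<mu> y"
  by (rule DERIV_pos_imp_increasing[of _ _ "prim \<mu>"]) (auto intro!: exI[of _ "\<mu> _"] prim_deriv \<mu>_pos)

lemma prim_pos: "0 < x \<Longrightarrow> 0 < prim \<mu> x"
  using prim_strict_mono[of "x / 2" x] prim_nonneg[of "x / 2"] by simp

lemma continuous_on_prim: "continuous_on {0<..} (prim \<mu>)"
  by (intro continuous_at_imp_continuous_on ballI DERIV_isCont[OF prim_deriv]) simp

text \<open>Fixes the lower end of the range of U, by dominated convergence over shrinking
  intervals; the upper end is \<open>prim_at_top\<close>. Together they make the substitution cover
  all of (0, \<infinity>).\<close>

lemma prim_tendsto_0: "(\<lambda>n. prim \<mu> (1 / real (Suc n))) \<longlonglongrightarrow> 0"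
proof -
  let ?s = "\<lambda>n x. indicator {0<..<1 / real (Suc n)} x *\<^sub>R \<mu> x"
  have sub: "{0<..<1 / real (Suc n)} \<subseteq> {0<..<1::real}" for n
    by (auto elim!: less_le_trans)
  have i: "integrable lborel (?s n)" for n
    using integrable_\<mu>[of "1 / real (Suc n)"] by (simp add: set_integrable_def)
  have "(\<lambda>n. integral\<^sup>L lborel (?s n)) \<longlonglongrightarrow> integral\<^sup>L lborel (\<lambda>_ :: real. 0 :: real)"
  proof (rule integral_dominated_convergence[where w = "\<lambda>x. indicator {0<..<1} x *\<^sub>R \<mu> x"])
    show "integrable lborel (\<lambda>x. indicator {0<..<1} x *\<^sub>R \<mu> x)"
      using integrable_\<mu>[of 1] by (simp add: set_integrable_def)
    show "AE x in lborel. norm (?s n x) \<le> indicator {0<..<1} x *\<^sub>R \<mu> x" for n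
      using sub[of n] \<mu>_pos by (intro AE_I2) (auto simp: indicator_def less_imp_le subset_iff)
    show "AE x in lborel. (\<lambda>n. ?s n x) \<longlonglongrightarrow> 0"
    proof (intro AE_I2)
      fix x :: real
      have "\<forall>\<^sub>F n in sequentially. ?s n x = 0"
      proof (cases "0 < x")
        case True
        have "(\<lambda>n. 1 / real (Suc n)) \<longlonglongrightarrow> 0" using LIMSEQ_Suc[OF lim_const_over_n[of 1]] by simp
        from order_tendstoD(2)[OF this True] show ?thesis
          by eventually_elim auto
      qed simp
      then show "(\<lambda>n. ?s n x) \<longlonglongrightarrow> 0" by (rule tendsto_eventually)
    qed
  qed (use i in \<open>auto dest: borel_measurable_integrable\<close>)
  then show ?thesis by (simp add: prim_def set_lebesgue_integral_def)
qed

lemma image_prim: "prim \<mu> ` {0<..} = {0<..}"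
proof safe
  fix y :: real assume y: "0 < y"
  from order_tendstoD(2)[OF prim_tendsto_0 y] obtain n where n: "prim \<mu> (1 / real (Suc n)) < y"
    by (auto simp: eventually_sequentially)
  define a where "a = 1 / real (Suc n)"
  have a: "0 < a" "prim \<mu> a < y" using n by (auto simp: a_def)
  have "\<forall>\<^sub>F x in at_top. y \<le> prim \<mu> x \<and> a \<le> x"
    using prim_at_top by (intro eventually_conj eventually_ge_at_top) (simp add: filterlim_at_top)
  then obtain b where b: "y \<le> prim \<mu> b" "a \<le> b" by (auto simp: eventually_at_top_linorder)
  have "\<exists>x\<ge>a. x \<le> b \<and> prim \<mu> x = y"
    by (rule IVT) (use a b in \<open>auto intro!: DERIV_isCont[OF prim_deriv]\<close>)
  then show "y \<in> prim \<mu> ` {0<..}" using a by auto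
qed (use prim_pos in auto)

text \<open>The derivative of U powr \<delta> is \<delta> times a nonnegative function, so \<delta>
  itself serves as the sign in the substitution rule.\<close>

lemma nn_integral_prim_powr:
  assumes \<delta>: "\<delta> \<in> {- 1, 1}" and G: "G \<in> borel_measurable borel"
  shows "(\<integral>\<^sup>+x\<in>{0<..}. ennreal (G (prim \<mu> x powr \<delta>) * (prim \<mu> x powr (\<delta> - 1) * \<mu> x)) \<partial>lborel)
      = (\<integral>\<^sup>+y\<in>{0<..}. ennreal (G y) \<partial>lborel)"
proof (rule nn_integral_substitution_halfline[OF _ \<delta> _ _ G])
  show "((\<lambda>x. prim \<mu> x powr \<delta>) has_real_derivative \<delta> * (prim \<mu> x powr (\<delta> - 1) * \<mu> x)) (at x)" if "0 < x" for x
    using prim_pos[OF that] by (auto intro!: derivative_eq_intros prim_deriv that)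
  show "0 \<le> prim \<mu> x powr (\<delta> - 1) * \<mu> x" if "0 < x" for x using \<mu>_pos[OF that] by simp
  show "continuous_on {0<..} (\<lambda>x. prim \<mu> x powr (\<delta> - 1) * \<mu> x)"
    by (intro continuous_intros continuous_on_prim cont_\<mu>) (use prim_pos in force)
  have "(\<lambda>x. prim \<mu> x powr \<delta>) ` {0<..} = (\<lambda>t. 1 * t powr \<delta>) ` prim \<mu> ` {0<..}"
    by (simp add: image_image)
  also have "\<dots> = {0<..}" unfolding image_prim using \<delta> by (intro image_powr_halfline) auto
  finally show "(\<lambda>x. prim \<mu> x powr \<delta>) ` {0<..} = {0<..}" .
qed

text \<open>The functions f are only Lebesgue measurable, so integrals containing f stay over this
  measure. Substitution is applied only to integrands free of f, where one can pass to
  \<open>lborel\<close>.\<close>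

abbreviation "L \<equiv> lebesgue_on {0 :: real<..}"

lemma measurable_prim_L [measurable]: "prim \<mu> \<in> borel_measurable L"
  by (rule continuous_imp_measurable_on_sets_lebesgue[OF continuous_on_prim]) simp

lemma measurable_\<mu>_L [measurable]: "\<mu> \<in> borel_measurable L"
  by (rule continuous_imp_measurable_on_sets_lebesgue[OF cont_\<mu>]) simp

lemma nn_integral_L: "(\<integral>\<^sup>+x. f x \<partial>L) = (\<integral>\<^sup>+x\<in>{0<..}. f x \<partial>lebesgue)"
  by (rule nn_integral_restrict_space) simp

lemma space_L [simp]: "x \<in> space L \<longleftrightarrow> 0 < x"
  by (simp add: space_restrict_space)

end

section \<open>The half-discrete inequality\<close>

text \<open>With these identities the extremal choices w * J powr (p - 1) and w * H powr (q - 1)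
  have weighted power sums equal to those of J and H.\<close>

lemma conjugate_weights:
  fixes w1 w2 p q :: real
  assumes p: "p < 0" "1 / p + 1 / q = 1" and pos: "0 < w1" "0 < w2" and w: "w1 powr (1 / p) * w2 powr (1 / q) = 1"
  shows "w2 * w1 powr q = w1" "w1 * w2 powr p = w2"
proof -
  note pq = powr_sum_eq_1[OF p]
  have l: "ln w1 / p + ln w2 / q = 0"
    using arg_cong[OF w, of ln] pos by (simp add: ln_mult ln_powr)
  then have "ln w2 = - (q / p) * ln w1" using pq(1) p by (simp add: field_simps)
  then have 1: "ln w2 + q * ln w1 = ln w1" using pq by (simp add: algebra_simps)
  have "ln w1 = - (p / q) * ln w2" using l pq(1) p by (simp add: field_simps)
  then have 2: "ln w1 + p * ln w2 = ln w2" using pq by (simp add: algebra_simps)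
  have "ln (w2 * w1 powr q) = ln w1" "ln (w1 * w2 powr p) = ln w2"
    using 1 2 pos by (simp_all add: ln_mult ln_powr)
  then show "w2 * w1 powr q = w1" "w1 * w2 powr p = w2" using pos by simp_all
qed

text \<open>The excluded values are real exceptions: for r < 0 and x = 0, or 0 < r < 1 and x =
  \<infinity>, the left side is 0 by convention and the right side is infinite.\<close>

lemma ennpowr_mult_self:
  assumes "r < 0 \<and> x \<noteq> 0 \<or> 0 < r \<and> r < 1 \<and> x \<noteq> \<infinity>"
  shows "ennpowr x (r - 1) * x = ennpowr x r"
  using assms
proof (cases x rule: ennreal_pos_cases)
  case (3 t)
  then have "t powr (r - 1) * t = t powr r" by (simp add: powr_diff)
  then show ?thesis using 3 by (simp add: ennpowr_ennreal ennreal_mult[symmetric])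
qed auto

lemma ennpowr_conjugate:
  assumes p: "p < 0" "1 / p + 1 / q = 1"
  shows "ennpowr (ennpowr x (p - 1)) q = ennpowr x p" "ennpowr (ennpowr x (q - 1)) p = ennpowr x q"
  using powr_sum_eq_1[OF p] p by (simp_all add: ennpowr_ennpowr)

lemma ennreal_mult_right_less_cancel: "a * c < b * c \<Longrightarrow> a < b" for a b c :: ennreal
  by (meson mult_right_mono not_le zero_le)

locale half_discrete = regular_weight \<mu> for \<mu> +
  fixes \<alpha> \<rho> \<gamma> \<sigma> \<beta> \<delta> p q :: real and \<nu> :: "nat \<Rightarrow> real"
  assumes \<rho>: "0 < \<rho>" "- \<alpha> < \<rho>" and \<gamma>: "0 < \<gamma>" "\<gamma> < \<sigma>" and \<sigma>: "\<sigma> \<le> 1"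
    and \<delta>: "\<delta> \<in> {- 1, 1}" and p: "p < 0" "1 / p + 1 / q = 1"
    and \<nu>_pos: "\<And>n. n \<ge> 1 \<Longrightarrow> \<nu> n > 0" and \<nu>_mono: "\<And>n. n \<ge> 1 \<Longrightarrow> \<nu> (Suc n) \<le> \<nu> n"
    and \<beta>: "\<beta> \<le> \<nu> 1 / 2" and psum_at_top: "filterlim (psum \<nu>) at_top sequentially"
begin

lemmas q = powr_sum_eq_1[OF p]

(* Sequence indices start at 0 from here on: V n, K x n, \<psi> n and \<psi>' n belong to the index n + 1 of the statement. *)
definition V :: "nat \<Rightarrow> real" where "V n = psum \<nu> (Suc n) - \<beta>"

definition W :: "real \<Rightarrow> real" where "W x = prim \<mu> x powr \<delta>"

definition K :: "real \<Rightarrow> nat \<Rightarrow> real" where "K x n = hker \<alpha> \<rho> \<gamma> (W x * V n)"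

definition \<phi> :: "real \<Rightarrow> real" where "\<phi> = Phi p \<sigma> \<delta> \<mu>"

definition \<psi> :: "nat \<Rightarrow> real" where "\<psi> n = Psi q \<sigma> \<beta> \<nu> (Suc n)"

text \<open>The primed weights belong to the left sides of the third and second inequalities; they
  are the weights dual to \<phi> and \<psi> in the reverse Hoelder inequality.\<close>

definition \<phi>' :: "real \<Rightarrow> real" where "\<phi>' x = \<mu> x / prim \<mu> x powr (1 - q * \<delta> * \<sigma>)"

definition \<psi>' :: "nat \<Rightarrow> real" where "\<psi>' n = \<nu> (Suc (Suc n)) / V n powr (1 - p * \<sigma>)"

definition J :: "(real \<Rightarrow> ennreal) \<Rightarrow> nat \<Rightarrow> ennreal" where
  "J F n = (\<integral>\<^sup>+x. ennreal (K x n) * F x \<partial>L)"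

definition H :: "(nat \<Rightarrow> ennreal) \<Rightarrow> real \<Rightarrow> ennreal" where
  "H A x = (\<Sum>n. ennreal (K x n) * A n)"

lemma V_pos: "0 < V n"
proof -
  have "0 < V 0" using \<beta> \<nu>_pos[of 1] by (simp add: V_def psum_def)
  moreover have "V k \<le> V (Suc k)" for k using \<nu>_pos[of "Suc (Suc k)"] by (simp add: V_def psum_Suc)
  then have "V 0 \<le> V n" by (rule lift_Suc_mono_le) simp
  ultimately show ?thesis by simp
qed

lemma W_pos: "0 < x \<Longrightarrow> 0 < W x"
  using prim_pos[of x] by (simp add: W_def)

lemma K_pos: "0 < x \<Longrightarrow> 0 < K x n"
  unfolding K_def using W_pos V_pos \<rho> by (intro hker_pos) auto

lemma csch_kernel_eq: "0 < x \<Longrightarrow> csch_kernel \<alpha> \<rho> \<gamma> \<beta> \<delta> \<mu> \<nu> x (Suc n) = K x n"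
  using V_pos[of n] prim_pos[of x]
  by (simp add: csch_kernel_def K_def hker_def W_def V_def powr_mult powr_powr mult.assoc)

lemma measurable_W [measurable]: "W \<in> borel_measurable L"
  unfolding W_def by measurable

lemma measurable_K [measurable]: "(\<lambda>x. K x n) \<in> borel_measurable L"
  unfolding K_def by measurable

lemma measurable_weights [measurable]: "\<phi> \<in> borel_measurable L" "\<phi>' \<in> borel_measurable L"
  unfolding \<phi>_def \<phi>'_def Phi_def by measurable

lemma measurable_H [measurable]: "H A \<in> borel_measurable L"
  unfolding H_def by measurable

lemma weights_pos: "0 < x \<Longrightarrow> 0 < \<phi> x" "0 < x \<Longrightarrow> 0 < \<phi>' x" "0 < \<psi> n" "0 < \<psi>' n"
  using prim_pos[of x] \<mu>_pos[of x] V_pos[of n] \<nu>_pos[of "Suc (Suc n)"]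
  by (simp_all add: \<phi>_def \<phi>'_def \<psi>_def \<psi>'_def Phi_def Psi_def V_def)

lemma \<phi>_\<phi>': "0 < x \<Longrightarrow> \<phi> x powr (1 / p) * \<phi>' x powr (1 / q) = 1"
proof -
  assume x: "0 < x"
  have pos: "0 < prim \<mu> x" "0 < \<mu> x" using x prim_pos \<mu>_pos by auto
  \<comment> \<open>Under the logarithm the identity is linear in ln U and ln \<mu>, and both
    coefficients are multiples of 1/p + 1/q - 1.\<close>
  have "ln (\<phi> x powr (1 / p) * \<phi>' x powr (1 / q))
      = ((p * (1 - \<delta> * \<sigma>) - 1) * ln (prim \<mu> x) - (p - 1) * ln (\<mu> x)) / p
        + (ln (\<mu> x) - (1 - q * \<delta> * \<sigma>) * ln (prim \<mu> x)) / q"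
    using pos by (simp add: \<phi>_def \<phi>'_def Phi_def ln_mult ln_powr ln_div)
  also have "\<dots> = (1 / p + 1 / q - 1) * (ln (\<mu> x) - ln (prim \<mu> x))"
    using p(1) q(1) by (simp add: divide_simps) (simp add: algebra_simps)
  finally show ?thesis using p weights_pos(1,2)[OF x] by simp
qed

lemma \<psi>'_\<psi>: "\<psi>' n powr (1 / p) * \<psi> n powr (1 / q) = 1"
proof -
  have pos: "0 < V n" "0 < \<nu> (Suc (Suc n))" using V_pos \<nu>_pos by auto
  have "ln (\<psi>' n powr (1 / p) * \<psi> n powr (1 / q))
      = (ln (\<nu> (Suc (Suc n))) - (1 - p * \<sigma>) * ln (V n)) / p
        + ((q * (1 - \<sigma>) - 1) * ln (V n) - (q - 1) * ln (\<nu> (Suc (Suc n)))) / q"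
    using pos by (simp add: \<psi>_def \<psi>'_def Psi_def V_def[symmetric] ln_mult ln_powr ln_div)
  also have "\<dots> = (1 / p + 1 / q - 1) * (ln (\<nu> (Suc (Suc n))) - ln (V n))"
    using p(1) q(1) by (simp add: divide_simps) (simp add: algebra_simps)
  finally show ?thesis using p weights_pos(3,4)[of n] by simp
qed

lemma nn_integral_K:
  "(\<integral>\<^sup>+x. ennreal (K x n * (\<mu> x * prim \<mu> x powr (\<delta> * \<sigma> - 1))) \<partial>L) = ennreal (V n powr (- \<sigma>)) * kconst \<alpha> \<rho> \<gamma> \<sigma>"
proof -
  let ?G = "\<lambda>y. hker \<alpha> \<rho> \<gamma> (V n * y) * y powr (\<sigma> - 1)"
  have "K x n * (\<mu> x * prim \<mu> x powr (\<delta> * \<sigma> - 1)) = ?G (prim \<mu> x powr \<delta>) * (prim \<mu> x powr (\<delta> - 1) * \<mu> x)" for x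
  proof -
    have "(prim \<mu> x powr \<delta>) powr (\<sigma> - 1) * prim \<mu> x powr (\<delta> - 1) = prim \<mu> x powr (\<delta> * \<sigma> - 1)"
      by (simp add: powr_powr algebra_simps flip: powr_add)
    then show ?thesis by (simp add: K_def W_def mult_ac)
  qed
  then have "(\<integral>\<^sup>+x. ennreal (K x n * (\<mu> x * prim \<mu> x powr (\<delta> * \<sigma> - 1))) \<partial>L)
      = (\<integral>\<^sup>+x\<in>{0<..}. ennreal (?G (prim \<mu> x powr \<delta>) * (prim \<mu> x powr (\<delta> - 1) * \<mu> x)) \<partial>lborel)"
    by (simp only: nn_integral_L nn_integral_completion)
  also have "\<dots> = (\<integral>\<^sup>+y\<in>{0<..}. ennreal (?G y) \<partial>lborel)"
    by (rule nn_integral_prim_powr[OF \<delta>]) measurable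
  also have "\<dots> = ennreal (V n powr (- \<sigma>)) * kconst \<alpha> \<rho> \<gamma> \<sigma>"
    by (rule nn_integral_hker_scale[OF V_pos])
  finally show ?thesis .
qed

definition kr :: real where "kr = enn2real (kconst \<alpha> \<rho> \<gamma> \<sigma>)"

lemma kr: "kconst \<alpha> \<rho> \<gamma> \<sigma> = ennreal kr" "0 < kr"
proof -
  show "kconst \<alpha> \<rho> \<gamma> \<sigma> = ennreal kr" using kconst_finite[OF \<rho> \<gamma>] by (simp add: kr_def)
  have "0 < hker \<alpha> \<rho> \<gamma> 1" using hker_pos \<rho> by simp
  also have "\<dots> \<le> \<sigma> * kr" using hker_le[OF \<rho> \<gamma>, of 1] by (simp add: kr_def)
  finally show "0 < kr" using \<gamma> by (simp add: zero_less_mult_iff)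
qed

lemma sum_K_less:
  assumes "0 < x" "\<gamma> < s" "s \<le> 1"
  shows "(\<Sum>n. ennreal (\<nu> (Suc (Suc n)) * (K x n * V n powr (s - 1)))) < ennreal (W x powr (- s)) * kconst \<alpha> \<rho> \<gamma> s"
  unfolding K_def V_def
  using weight_sum_less[OF \<nu>_pos \<nu>_mono \<beta> \<rho> \<gamma>(1) assms(2,3) W_pos[OF assms(1)]] by simp

(* Jensen's inequality for t powr p and the probability measure with density proportional to K x n * m x,
   written as a reverse Hoelder inequality. *)
lemma J_powr_le:
  assumes [measurable]: "F \<in> borel_measurable L"
  defines "m \<equiv> \<lambda>x. \<mu> x * prim \<mu> x powr (\<delta> * \<sigma> - 1)"
  shows "ennreal (\<psi>' n) * ennpowr (J F n) p
    \<le> ennreal (kr powr (p - 1)) * (\<integral>\<^sup>+x. ennreal (\<nu> (Suc (Suc n)) * (K x n * V n powr (\<sigma> - 1))) * (ennreal (m x powr (1 - p)) * ennpowr (F x) p) \<partial>L)"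
proof -
  have [measurable]: "m \<in> borel_measurable L" unfolding m_def by measurable
  have m: "0 < m x" if "0 < x" for x using prim_pos[OF that] \<mu>_pos[OF that] by (simp add: m_def)
  \<comment> \<open>The total mass of the density K x n * m x, known exactly from the integral
    weight.\<close>
  define M where "M = V n powr (- \<sigma>) * kr"
  have M: "0 < M" using V_pos[of n] kr by (simp add: M_def)
  \<comment> \<open>The weight of F here and the weight m * K powr (1 - q) of K below are conjugate;
    the latter reduces the K-integral to M, since K powr (1 - q) * K powr q = K.\<close>
  let ?X = "\<integral>\<^sup>+x. ennreal (K x n * m x powr (1 - p)) * ennpowr (F x) p \<partial>L"
  have "(\<integral>\<^sup>+x. ennreal (m x * K x n powr (1 - q)) * ennpowr (ennreal (K x n)) q \<partial>L) = (\<integral>\<^sup>+x. ennreal (K x n * m x) \<partial>L)"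
  proof (intro nn_integral_cong)
    fix x assume "x \<in> space L"
    then have "0 < K x n" "0 < m x" using K_pos m by auto
    moreover from this have "K x n powr (1 - q) * K x n powr q = K x n" by (simp flip: powr_add)
    ultimately show "ennreal (m x * K x n powr (1 - q)) * ennpowr (ennreal (K x n)) q = ennreal (K x n * m x)"
      by (simp add: ennpowr_ennreal ennreal_mult'[symmetric] mult_ac)
  qed
  also have "\<dots> = ennreal M"
    using nn_integral_K[of n] kr V_pos[of n] by (simp add: m_def M_def ennreal_mult)
  finally have G: "(\<integral>\<^sup>+x. ennreal (m x * K x n powr (1 - q)) * ennpowr (ennreal (K x n)) q \<partial>L) = ennreal M" .
  have "ennpowr ?X (1 / p) * ennpowr (\<integral>\<^sup>+x. ennreal (m x * K x n powr (1 - q)) * ennpowr (ennreal (K x n)) q \<partial>L) (1 / q)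
     \<le> (\<integral>\<^sup>+x. F x * ennreal (K x n) \<partial>L)"
  proof (rule rev_holder_weighted[OF p])
    fix x assume "x \<in> space L"
    then have pos: "0 < K x n" "0 < m x" using K_pos m by auto
    then show "0 < K x n * m x powr (1 - p)" "0 < m x * K x n powr (1 - q)" by auto
    have "ln ((K x n * m x powr (1 - p)) powr (1 / p) * (m x * K x n powr (1 - q)) powr (1 / q))
      = (ln (K x n) + (1 - p) * ln (m x)) / p + (ln (m x) + (1 - q) * ln (K x n)) / q"
      using pos by (simp add: ln_mult ln_powr)
    also have "\<dots> = (1 / p + 1 / q - 1) * (ln (K x n) + ln (m x))"
      using p(1) q(1) by (simp add: divide_simps) (simp add: algebra_simps)
    finally show "(K x n * m x powr (1 - p)) powr (1 / p) * (m x * K x n powr (1 - q)) powr (1 / q) = 1"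
      using p pos by simp
  qed measurable
  then have "ennreal (M powr (1 / q)) * ennpowr ?X (1 / p) \<le> J F n"
    unfolding G J_def using M by (simp add: ennpowr_ennreal mult.commute)
  then have "ennpowr (J F n) p \<le> ennpowr (ennreal (M powr (1 / q)) * ennpowr ?X (1 / p)) p"
    by (rule ennpowr_antimono[OF p(1)])
  also have "\<dots> = ennreal (M powr (p - 1)) * ?X"
    using M p q by (simp add: ennpowr_cmult ennpowr_ennpowr powr_powr)
  finally have "ennreal (\<psi>' n) * ennpowr (J F n) p \<le> ennreal (\<psi>' n) * (ennreal (M powr (p - 1)) * ?X)"
    by (rule mult_left_mono) simp
  also have "\<dots> = ennreal (\<psi>' n * M powr (p - 1)) * ?X"
    using weights_pos by (simp add: ennreal_mult less_imp_le mult.assoc)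
  \<comment> \<open>The powers of V n combine to the exponent \<sigma> - 1 of the summation weight,
    ready for the sum over n.\<close>
  also have "\<psi>' n * M powr (p - 1) = kr powr (p - 1) * (\<nu> (Suc (Suc n)) * V n powr (\<sigma> - 1))"
  proof -
    have "M powr (p - 1) = V n powr (- \<sigma> * (p - 1)) * kr powr (p - 1)"
      using V_pos[of n] kr by (simp add: M_def powr_mult powr_powr)
    moreover have "V n powr (- \<sigma> * (p - 1)) = V n powr (\<sigma> - 1) * V n powr (1 - p * \<sigma>)"
      by (simp add: algebra_simps flip: powr_add)
    ultimately show ?thesis using V_pos[of n] by (simp add: \<psi>'_def)
  qed
  also have "ennreal (kr powr (p - 1) * (\<nu> (Suc (Suc n)) * V n powr (\<sigma> - 1))) * ?X
    = ennreal (kr powr (p - 1)) * (\<integral>\<^sup>+x. ennreal (\<nu> (Suc (Suc n)) * V n powr (\<sigma> - 1)) * (ennreal (K x n * m x powr (1 - p)) * ennpowr (F x) p) \<partial>L)"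
    using \<nu>_pos[of "Suc (Suc n)"] by (subst nn_integral_cmult) (simp_all add: ennreal_mult mult.assoc)
  also have "(\<integral>\<^sup>+x. ennreal (\<nu> (Suc (Suc n)) * V n powr (\<sigma> - 1)) * (ennreal (K x n * m x powr (1 - p)) * ennpowr (F x) p) \<partial>L)
    = (\<integral>\<^sup>+x. ennreal (\<nu> (Suc (Suc n)) * (K x n * V n powr (\<sigma> - 1))) * (ennreal (m x powr (1 - p)) * ennpowr (F x) p) \<partial>L)"
  proof (intro nn_integral_cong)
    fix x assume "x \<in> space L"
    then have "0 < K x n" using K_pos by auto
    then show "ennreal (\<nu> (Suc (Suc n)) * V n powr (\<sigma> - 1)) * (ennreal (K x n * m x powr (1 - p)) * ennpowr (F x) p)
      = ennreal (\<nu> (Suc (Suc n)) * (K x n * V n powr (\<sigma> - 1))) * (ennreal (m x powr (1 - p)) * ennpowr (F x) p)"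
      using \<nu>_pos[of "Suc (Suc n)"] by (simp add: ennreal_mult less_imp_le mult_ac)
  qed
  finally show ?thesis .
qed

text \<open>Sum and integral are exchanged, and the summation weight is strictly below its bound at
  every x. The strictness survives integration because the norm integral of F is finite and not
  zero. The factor kr powr p becomes kr under the root 1/p.\<close>

lemma sum_J_powr_less:
  assumes [measurable]: "F \<in> borel_measurable L"
    and I: "0 < (\<integral>\<^sup>+x. ennreal (\<phi> x) * ennpowr (F x) p \<partial>L)" "(\<integral>\<^sup>+x. ennreal (\<phi> x) * ennpowr (F x) p \<partial>L) < \<infinity>"
  shows "(\<Sum>n. ennreal (\<psi>' n) * ennpowr (J F n) p) < ennreal (kr powr p) * (\<integral>\<^sup>+x. ennreal (\<phi> x) * ennpowr (F x) p \<partial>L)"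
proof -
  define m where "m x = \<mu> x * prim \<mu> x powr (\<delta> * \<sigma> - 1)" for x
  define t where "t n x = ennreal (\<nu> (Suc (Suc n)) * (K x n * V n powr (\<sigma> - 1)))" for n x
  define g where "g x = ennreal (m x powr (1 - p)) * ennpowr (F x) p" for x
  have [measurable]: "m \<in> borel_measurable L" unfolding m_def by measurable
  have [measurable]: "t n \<in> borel_measurable L" for n unfolding t_def by measurable
  have [measurable]: "g \<in> borel_measurable L" unfolding g_def by measurable
  \<comment> \<open>The origin of the weight Phi: it is what the density m and the bound of the
    summation weight leave in front of F powr p.\<close>
  have gw: "g x * ennreal (W x powr (- \<sigma>)) = ennreal (\<phi> x) * ennpowr (F x) p" if "0 < x" for x
  proof -
    have pos: "0 < prim \<mu> x" "0 < \<mu> x" using that prim_pos \<mu>_pos by auto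
    have "ln (m x powr (1 - p) * W x powr (- \<sigma>)) = ln (\<phi> x)"
      using pos by (simp add: m_def W_def \<phi>_def Phi_def ln_mult ln_powr ln_div algebra_simps)
    moreover have "0 < m x powr (1 - p) * W x powr (- \<sigma>)" using pos W_pos[OF that] by (simp add: m_def)
    ultimately have "m x powr (1 - p) * W x powr (- \<sigma>) = \<phi> x" using weights_pos(1)[OF that] by simp
    then show ?thesis by (simp add: g_def mult_ac ennreal_mult[symmetric] flip: ennreal_mult')
  qed
  have t_less: "(\<Sum>n. t n x) < ennreal (W x powr (- \<sigma>)) * ennreal kr" if "0 < x" for x
    using sum_K_less[OF that \<gamma>(2) \<sigma>] by (simp add: t_def kr)
  have kI: "(\<integral>\<^sup>+x. (ennreal (W x powr (- \<sigma>)) * ennreal kr) * g x \<partial>L) = ennreal kr * (\<integral>\<^sup>+x. ennreal (\<phi> x) * ennpowr (F x) p \<partial>L)"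
  proof -
    have "(\<integral>\<^sup>+x. (ennreal (W x powr (- \<sigma>)) * ennreal kr) * g x \<partial>L)
        = (\<integral>\<^sup>+x. ennreal kr * (ennreal (\<phi> x) * ennpowr (F x) p) \<partial>L)"
    proof (intro nn_integral_cong)
      fix x assume "x \<in> space L"
      then have "0 < x" by simp
      have "(ennreal (W x powr (- \<sigma>)) * ennreal kr) * g x = ennreal kr * (g x * ennreal (W x powr (- \<sigma>)))"
        by (simp only: mult_ac)
      then show "(ennreal (W x powr (- \<sigma>)) * ennreal kr) * g x = ennreal kr * (ennreal (\<phi> x) * ennpowr (F x) p)"
        by (simp only: gw[OF \<open>0 < x\<close>])
    qed
    then show ?thesis by (simp add: nn_integral_cmult)
  qed
  have "(\<Sum>n. ennreal (\<psi>' n) * ennpowr (J F n) p) \<le> (\<Sum>n. ennreal (kr powr (p - 1)) * (\<integral>\<^sup>+x. t n x * g x \<partial>L))"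
    unfolding t_def g_def m_def by (intro suminf_le J_powr_le) auto
  also have "\<dots> = ennreal (kr powr (p - 1)) * (\<integral>\<^sup>+x. (\<Sum>n. t n x) * g x \<partial>L)"
    by (simp add: nn_integral_suminf[symmetric])
  also have "\<dots> < ennreal (kr powr (p - 1)) * (\<integral>\<^sup>+x. (ennreal (W x powr (- \<sigma>)) * ennreal kr) * g x \<partial>L)"
  proof (rule ennreal_mult_strict_left_mono)
    have le: "(\<Sum>n. t n x) * g x \<le> (ennreal (W x powr (- \<sigma>)) * ennreal kr) * g x" if "0 < x" for x
      using t_less[OF that] by (intro mult_right_mono) auto
    show "(\<integral>\<^sup>+x. (\<Sum>n. t n x) * g x \<partial>L) < (\<integral>\<^sup>+x. (ennreal (W x powr (- \<sigma>)) * ennreal kr) * g x \<partial>L)"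
    proof (rule nn_integral_less)
      have "(\<integral>\<^sup>+x. (\<Sum>n. t n x) * g x \<partial>L) \<le> (\<integral>\<^sup>+x. (ennreal (W x powr (- \<sigma>)) * ennreal kr) * g x \<partial>L)"
        using le by (intro nn_integral_mono) auto
      also have "\<dots> < \<infinity>" unfolding kI using I by (simp add: ennreal_mult_less_top)
      finally show "(\<integral>\<^sup>+x. (\<Sum>n. t n x) * g x \<partial>L) \<noteq> \<infinity>" by simp
      show "AE x in L. (\<Sum>n. t n x) * g x \<le> (ennreal (W x powr (- \<sigma>)) * ennreal kr) * g x"
        using le by (intro AE_I2) auto
      \<comment> \<open>Where g x is neither 0 nor infinite the inequality is strict, so the reverse
        inequality almost everywhere would make the norm integral vanish.\<close>
      show "\<not> (AE x in L. (ennreal (W x powr (- \<sigma>)) * ennreal kr) * g x \<le> (\<Sum>n. t n x) * g x)"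
      proof
        assume "AE x in L. (ennreal (W x powr (- \<sigma>)) * ennreal kr) * g x \<le> (\<Sum>n. t n x) * g x"
        moreover have "AE x in L. ennreal (\<phi> x) * ennpowr (F x) p \<noteq> \<infinity>"
          using I by (intro nn_integral_noteq_infinite) auto
        moreover have "AE x in L. 0 < x" by (rule AE_I2) simp
        ultimately have "AE x in L. ennreal (\<phi> x) * ennpowr (F x) p = 0"
        proof eventually_elim
          fix x assume x: "0 < x" and fin: "ennreal (\<phi> x) * ennpowr (F x) p \<noteq> \<infinity>"
            and ge: "(ennreal (W x powr (- \<sigma>)) * ennreal kr) * g x \<le> (\<Sum>n. t n x) * g x"
          have "g x \<noteq> \<infinity>" using fin W_pos[OF x] by (auto simp: gw[OF x, symmetric] ennreal_mult_eq_top_iff)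
          have "g x = 0"
          proof (rule ccontr)
            assume "g x \<noteq> 0"
            then have "(\<Sum>n. t n x) * g x < (ennreal (W x powr (- \<sigma>)) * ennreal kr) * g x"
              using \<open>g x \<noteq> \<infinity>\<close> t_less[OF x]
              by (intro ennreal_mult_strict_right_mono) (auto simp: less_top zero_less_iff_neq_zero)
            with ge show False by simp
          qed
          then show "ennreal (\<phi> x) * ennpowr (F x) p = 0" by (simp add: gw[OF x, symmetric])
        qed
        then have "(\<integral>\<^sup>+x. ennreal (\<phi> x) * ennpowr (F x) p \<partial>L) = 0"
          by (subst nn_integral_0_iff_AE) auto
        with I show False by simp
      qed
    qed measurable
  qed (use kr in auto)
  also have "\<dots> = ennreal (kr powr (p - 1) * kr) * (\<integral>\<^sup>+x. ennreal (\<phi> x) * ennpowr (F x) p \<partial>L)"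
    unfolding kI using kr(2) by (simp add: ennreal_mult mult.assoc)
  also have "kr powr (p - 1) * kr = kr powr p" using kr(2) by (simp add: powr_diff)
  finally show ?thesis .
qed

subsection \<open>Equivalence of the three inequalities\<close>

definition fint :: "(real \<Rightarrow> real) \<Rightarrow> ennreal" where
  "fint f = (\<integral>\<^sup>+x. ennreal (\<phi> x) * ennpowr (ennreal (f x)) p \<partial>L)"

definition asum :: "(nat \<Rightarrow> real) \<Rightarrow> ennreal" where
  "asum a = (\<Sum>n. ennreal (\<psi> n) * ennpowr (ennreal (a (Suc n))) q)"

definition Jsum :: "(real \<Rightarrow> real) \<Rightarrow> ennreal" where
  "Jsum f = (\<Sum>n. ennreal (\<psi>' n) * ennpowr (J (\<lambda>x. ennreal (f x)) n) p)"

definition Hint :: "(nat \<Rightarrow> real) \<Rightarrow> ennreal" where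
  "Hint a = (\<integral>\<^sup>+x. ennreal (\<phi>' x) * ennpowr (H (\<lambda>n. ennreal (a (Suc n))) x) q \<partial>L)"

definition bilin :: "(real \<Rightarrow> real) \<Rightarrow> (nat \<Rightarrow> real) \<Rightarrow> ennreal" where
  "bilin f a = (\<Sum>n. J (\<lambda>x. ennreal (f x)) n * ennreal (a (Suc n)))"

abbreviation "FF \<equiv> fclass p \<phi>"
abbreviation "AA \<equiv> aclass q (Psi q \<sigma> \<beta> \<nu>)"

text \<open>The constant is any element of [0,\<infinity>], and the norms appear as roots of plain
  sums and integrals, whose zero and infinite values are easier to follow.\<close>

definition "ineq1 C \<longleftrightarrow> (\<forall>f\<in>FF. \<forall>a\<in>AA. C * ennpowr (fint f) (1 / p) * ennpowr (asum a) (1 / q) < bilin f a)"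
definition "ineq2 C \<longleftrightarrow> (\<forall>f\<in>FF. C * ennpowr (fint f) (1 / p) < ennpowr (Jsum f) (1 / p))"
definition "ineq3 C \<longleftrightarrow> (\<forall>a\<in>AA. C * ennpowr (asum a) (1 / q) < ennpowr (Hint a) (1 / q))"

lemma fnorm_eq: "fnorm p \<phi> f = ennpowr (fint f) (1 / p)"
  by (simp add: fnorm_def fint_def nn_integral_L)

lemma anorm_eq: "anorm q (Psi q \<sigma> \<beta> \<nu>) a = ennpowr (asum a) (1 / q)"
  by (simp add: anorm_def asum_def \<psi>_def)

lemma FF_iff: "f \<in> FF \<longleftrightarrow> f \<in> borel_measurable L \<and> (\<forall>x>0. 0 \<le> f x) \<and> 0 < fint f \<and> fint f < \<infinity>"
  using ennpowr_pos_finite_iff[of "1 / p" "fint f"] p by (auto simp: fclass_def fnorm_eq)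

lemma AA_iff: "a \<in> AA \<longleftrightarrow> (\<forall>n\<ge>1. 0 \<le> a n) \<and> 0 < asum a \<and> asum a < \<infinity>"
  using ennpowr_pos_finite_iff[of "1 / q" "asum a"] q by (auto simp: aclass_def anorm_eq)

lemma FF_measurable: "f \<in> FF \<Longrightarrow> (\<lambda>x. ennreal (f x)) \<in> borel_measurable L"
  by (intro measurable_compose[OF _ measurable_ennreal]) (simp add: FF_iff)

lemma J_eq: "J F n = (\<integral>\<^sup>+x\<in>{0<..}. ennreal (csch_kernel \<alpha> \<rho> \<gamma> \<beta> \<delta> \<mu> \<nu> x (Suc n)) * F x \<partial>lebesgue)"
  unfolding J_def nn_integral_L
  by (intro nn_integral_cong) (simp add: indicator_def csch_kernel_eq)

lemma bilin_eq:
  assumes [measurable]: "(\<lambda>x. ennreal (f x)) \<in> borel_measurable L"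
  shows "bilin f a = (\<Sum>n. \<integral>\<^sup>+x\<in>{0<..}. ennreal (csch_kernel \<alpha> \<rho> \<gamma> \<beta> \<delta> \<mu> \<nu> x (Suc n)) * ennreal (a (Suc n)) * ennreal (f x) \<partial>lebesgue)"
  unfolding bilin_def
proof (intro suminf_cong)
  fix n
  have "(\<integral>\<^sup>+x\<in>{0<..}. ennreal (csch_kernel \<alpha> \<rho> \<gamma> \<beta> \<delta> \<mu> \<nu> x (Suc n)) * ennreal (a (Suc n)) * ennreal (f x) \<partial>lebesgue)
    = (\<integral>\<^sup>+x. ennreal (K x n) * ennreal (f x) * ennreal (a (Suc n)) \<partial>L)"
    unfolding nn_integral_L
    by (intro nn_integral_cong) (auto simp: indicator_def csch_kernel_eq mult_ac)
  also have "\<dots> = J (\<lambda>x. ennreal (f x)) n * ennreal (a (Suc n))"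
    unfolding J_def by (rule nn_integral_multc) measurable
  finally show "J (\<lambda>x. ennreal (f x)) n * ennreal (a (Suc n))
    = (\<integral>\<^sup>+x\<in>{0<..}. ennreal (csch_kernel \<alpha> \<rho> \<gamma> \<beta> \<delta> \<mu> \<nu> x (Suc n)) * ennreal (a (Suc n)) * ennreal (f x) \<partial>lebesgue)"
    by simp
qed

lemma bilin_eq_H:
  assumes [measurable]: "(\<lambda>x. ennreal (f x)) \<in> borel_measurable L"
  shows "bilin f a = (\<integral>\<^sup>+x. ennreal (f x) * H (\<lambda>n. ennreal (a (Suc n))) x \<partial>L)"
proof -
  have "bilin f a = (\<Sum>n. \<integral>\<^sup>+x. ennreal (f x) * (ennreal (K x n) * ennreal (a (Suc n))) \<partial>L)"
    unfolding bilin_def J_def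
    by (subst nn_integral_multc[symmetric]) (auto simp: mult_ac)
  also have "\<dots> = (\<integral>\<^sup>+x. (\<Sum>n. ennreal (f x) * (ennreal (K x n) * ennreal (a (Suc n)))) \<partial>L)"
    by (rule nn_integral_suminf[symmetric]) measurable
  finally show ?thesis by (simp add: H_def)
qed

lemma Hint_eq:
  "Hint a = (\<integral>\<^sup>+x\<in>{0<..}. ennreal (\<mu> x / prim \<mu> x powr (1 - q * \<delta> * \<sigma>))
      * ennpowr (\<Sum>n. ennreal (csch_kernel \<alpha> \<rho> \<gamma> \<beta> \<delta> \<mu> \<nu> x (Suc n)) * ennreal (a (Suc n))) q \<partial>lebesgue)"
  unfolding Hint_def nn_integral_L \<phi>'_def H_def
  by (intro nn_integral_cong) (simp add: indicator_def csch_kernel_eq)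

lemma ineq2_kconst: "ineq2 (kconst \<alpha> \<rho> \<gamma> \<sigma>)"
  unfolding ineq2_def
proof
  fix f assume f: "f \<in> FF"
  have "Jsum f < ennreal (kr powr p) * fint f"
    using f sum_J_powr_less[OF FF_measurable[OF f]] by (simp add: FF_iff Jsum_def fint_def)
  then have "ennpowr (ennreal (kr powr p) * fint f) (1 / p) < ennpowr (Jsum f) (1 / p)"
    using p by (intro ennpowr_strict_antimono) auto
  then show "kconst \<alpha> \<rho> \<gamma> \<sigma> * ennpowr (fint f) (1 / p) < ennpowr (Jsum f) (1 / p)"
    using p kr by (simp add: ennpowr_cmult powr_powr)
qed

lemma rev_holder_J:
  "ennpowr (Jsum f) (1 / p) * ennpowr (asum a) (1 / q) \<le> bilin f a"
  using rev_holder_weighted[OF p, of "J (\<lambda>x. ennreal (f x))" "count_space UNIV" "\<lambda>n. ennreal (a (Suc n))" \<psi>' \<psi>]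
    weights_pos \<psi>'_\<psi>
  by (simp add: nn_integral_count_space_nat Jsum_def asum_def bilin_def)

lemma rev_holder_H:
  assumes "f \<in> FF" shows "ennpowr (fint f) (1 / p) * ennpowr (Hint a) (1 / q) \<le> bilin f a"
  using rev_holder_weighted[OF p, of "\<lambda>x. ennreal (f x)" L "H (\<lambda>n. ennreal (a (Suc n)))" \<phi> \<phi>']
    weights_pos \<phi>_\<phi>' FF_measurable[OF assms]
  by (simp add: fint_def Hint_def bilin_eq_H)

lemma ineq2_imp_ineq1: "ineq2 C \<Longrightarrow> ineq1 C"
  unfolding ineq1_def ineq2_def
proof (intro ballI)
  fix f a assume *: "\<forall>f\<in>FF. C * ennpowr (fint f) (1 / p) < ennpowr (Jsum f) (1 / p)" and f: "f \<in> FF" and a: "a \<in> AA"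
  have "C * ennpowr (fint f) (1 / p) * ennpowr (asum a) (1 / q) < ennpowr (Jsum f) (1 / p) * ennpowr (asum a) (1 / q)"
    using * f a ennpowr_pos_finite[of "asum a"] by (intro ennreal_mult_strict_right_mono) (auto simp: AA_iff)
  also have "\<dots> \<le> bilin f a" by (rule rev_holder_J)
  finally show "C * ennpowr (fint f) (1 / p) * ennpowr (asum a) (1 / q) < bilin f a" .
qed

lemma ineq3_imp_ineq1: "ineq3 C \<Longrightarrow> ineq1 C"
  unfolding ineq1_def ineq3_def
proof (intro ballI)
  fix f a assume *: "\<forall>a\<in>AA. C * ennpowr (asum a) (1 / q) < ennpowr (Hint a) (1 / q)" and f: "f \<in> FF" and a: "a \<in> AA"
  have "ennpowr (fint f) (1 / p) * (C * ennpowr (asum a) (1 / q)) < ennpowr (fint f) (1 / p) * ennpowr (Hint a) (1 / q)"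
    using * f a ennpowr_pos_finite[of "fint f"] by (intro ennreal_mult_strict_left_mono) (auto simp: FF_iff)
  also have "\<dots> \<le> bilin f a" by (rule rev_holder_H[OF f])
  finally show "C * ennpowr (fint f) (1 / p) * ennpowr (asum a) (1 / q) < bilin f a" by (simp add: mult_ac)
qed

text \<open>For the extremal sequence reverse Hoelder is an equality: its power sum and the bilinear
  form both equal Jsum f, and a factor Jsum f powr (1/q) cancels. That Jsum f is finite is not drawn
  from the assumed inequality but from the bound already proved.\<close>

lemma ineq1_imp_ineq2:
  assumes "ineq1 C" and C: "C < \<infinity>" shows "ineq2 C"
  unfolding ineq2_def
proof
  fix f assume f: "f \<in> FF"
  let ?J = "J (\<lambda>x. ennreal (f x))"
  have "Jsum f < ennreal (kr powr p) * fint f"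
    using f sum_J_powr_less[OF FF_measurable[OF f]] by (simp add: FF_iff Jsum_def fint_def)
  also have "\<dots> < \<infinity>" using f by (simp add: FF_iff ennreal_mult_less_top)
  finally have S: "Jsum f < \<infinity>" .
  show "C * ennpowr (fint f) (1 / p) < ennpowr (Jsum f) (1 / p)"
  \<comment> \<open>This case means that all inner integrals are infinite; then the left side of the
    second inequality is \<infinity> and only C < \<infinity> is used.\<close>
  proof (cases "Jsum f = 0")
    case True
    then show ?thesis using C f p ennpowr_pos_finite[of "fint f" "1 / p"] by (simp add: FF_iff ennreal_mult_less_top)
  next
    case False
    have J: "?J n \<noteq> 0" for n
    proof
      assume "?J n = 0"
      then have "ennreal (\<psi>' n) * ennpowr (?J n) p = \<infinity>" using p weights_pos(4)[of n] by (simp add: ennreal_mult_top)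
      moreover have "ennreal (\<psi>' n) * ennpowr (?J n) p < \<infinity>"
        using S unfolding Jsum_def by (rule ennreal_suminf_lessD)
      ultimately show False by simp
    qed
    define A where "A n = ennreal (\<psi>' n) * ennpowr (?J n) (p - 1)" for n
    \<comment> \<open>The shift returns from indices starting at 0 to those of the statement; the
      value at 0 is irrelevant.\<close>
    define a where "a n = enn2real (A (n - 1))" for n
    have aA: "ennreal (a (Suc n)) = A n" for n
    proof -
      have "ennpowr (?J n) (p - 1) < \<infinity>"
        using J[of n] p by (cases "?J n" rule: ennreal_pos_cases) (auto simp: ennpowr_ennreal)
      then show ?thesis by (simp add: a_def A_def ennreal_mult_less_top)
    qed
    have "asum a = Jsum f"
      unfolding asum_def Jsum_def
    proof (intro suminf_cong)
      fix n
      note w = weights_pos(3,4)[of n]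
      have "ennreal (\<psi> n) * ennpowr (A n) q = ennreal (\<psi> n * \<psi>' n powr q) * ennpowr (?J n) p"
        using w by (simp add: A_def ennpowr_cmult ennpowr_conjugate[OF p] ennreal_mult mult.assoc)
      then show "ennreal (\<psi> n) * ennpowr (ennreal (a (Suc n))) q = ennreal (\<psi>' n) * ennpowr (?J n) p"
        using conjugate_weights(1)[OF p w(2,1) \<psi>'_\<psi>] by (simp add: aA)
    qed
    moreover have "bilin f a = Jsum f"
      unfolding bilin_def Jsum_def
    proof (intro suminf_cong)
      fix n
      show "?J n * ennreal (a (Suc n)) = ennreal (\<psi>' n) * ennpowr (?J n) p"
        using ennpowr_mult_self[of p "?J n"] J[of n] p by (simp add: aA A_def mult_ac)
    qed
    moreover have "a \<in> AA"
      using \<open>asum a = Jsum f\<close> S False by (auto simp: AA_iff a_def zero_less_iff_neq_zero)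
    ultimately have "C * ennpowr (fint f) (1 / p) * ennpowr (Jsum f) (1 / q) < Jsum f"
      using assms f unfolding ineq1_def by metis
    also have "Jsum f = ennpowr (Jsum f) (1 / p) * ennpowr (Jsum f) (1 / q)"
      using S False p by (subst ennpowr_add[symmetric]) (auto simp: zero_less_iff_neq_zero)
    finally show ?thesis by (rule ennreal_mult_right_less_cancel)
  qed
qed

text \<open>Needed because q - 1 < 0: a zero of H would make the extremal function infinite
  there.\<close>

lemma H_pos:
  assumes "a \<in> AA" "0 < x" shows "0 < H (\<lambda>n. ennreal (a (Suc n))) x"
proof -
  have "\<exists>n. a (Suc n) > 0"
  proof (rule ccontr)
    assume "\<not> ?thesis"
    then have "ennreal (a (Suc n)) = 0" for n by (auto simp: ennreal_eq_0_iff not_less)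
    then have "asum a = 0" using q by (simp add: asum_def)
    then show False using assms by (simp add: AA_iff)
  qed
  then obtain n where "a (Suc n) > 0" by blast
  then have "0 < ennreal (K x n) * ennreal (a (Suc n))"
    using K_pos[OF assms(2), of n] by (simp add: ennreal_zero_less_mult_iff)
  also have "\<dots> \<le> H (\<lambda>n. ennreal (a (Suc n))) x"
    unfolding H_def using sum_le_suminf[of "\<lambda>n. ennreal (K x n) * ennreal (a (Suc n))" "{n}"] by simp
  finally show ?thesis .
qed

lemma Hint_pos:
  assumes "a \<in> AA" shows "0 < Hint a"
proof (rule ccontr)
  assume "\<not> 0 < Hint a"
  then have "Hint a = 0" by (simp add: not_less)
  then have "AE x in L. ennreal (\<phi>' x) * ennpowr (H (\<lambda>n. ennreal (a (Suc n))) x) q = 0"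
    unfolding Hint_def by (subst (asm) nn_integral_0_iff_AE) auto
  moreover have "AE x in L. 0 < x" by (rule AE_I2) simp
  ultimately have "AE x in L. False"
  proof eventually_elim
    fix x :: real
    assume "ennreal (\<phi>' x) * ennpowr (H (\<lambda>n. ennreal (a (Suc n))) x) q = 0" "0 < x"
    then show False
      using ennpowr_strict_mono[OF q(1) H_pos[OF assms], of x] weights_pos(2)[of x] q(1) by auto
  qed
  then have "AE x in L. x \<notin> space L" by eventually_elim simp
  then have "space L \<in> null_sets L" by (simp only: AE_iff_null_sets sets.top)
  then have "emeasure lborel {0 :: real<..} = 0"
    by (auto dest!: null_setsD1 simp: emeasure_restrict_space space_restrict_space)
  moreover have "emeasure lborel {0 :: real<..<1} \<le> emeasure lborel {0 :: real<..}"
    by (rule emeasure_mono) auto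
  ultimately show False by simp
qed

lemma extremal_f:
  assumes a: "a \<in> AA" and fin: "Hint a < \<infinity>"
  obtains f where "f \<in> FF" "fint f = Hint a" "bilin f a = Hint a"
proof -
  let ?H = "H (\<lambda>n. ennreal (a (Suc n)))"
  define F where "F x = ennreal (\<phi>' x) * ennpowr (?H x) (q - 1)" for x
  define f where "f x = enn2real (F x)" for x
  have [measurable]: "F \<in> borel_measurable L" unfolding F_def by measurable
  have fF: "ennreal (f x) = F x" if "0 < x" for x
  proof -
    have "ennpowr (?H x) (q - 1) < \<infinity>"
      using H_pos[OF a that] q by (cases "?H x" rule: ennreal_pos_cases) (auto simp: ennpowr_ennreal)
    then show ?thesis by (simp add: f_def F_def ennreal_mult_less_top)
  qed
  have "fint f = Hint a"
    unfolding fint_def Hint_def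
  proof (intro nn_integral_cong)
    fix x assume "x \<in> space L"
    then have x: "0 < x" by simp
    note w = weights_pos(1,2)[OF x]
    have "ennreal (\<phi> x) * ennpowr (F x) p = ennreal (\<phi> x * \<phi>' x powr p) * ennpowr (?H x) q"
      using w by (simp add: F_def ennpowr_cmult ennpowr_conjugate[OF p] ennreal_mult mult.assoc)
    then show "ennreal (\<phi> x) * ennpowr (ennreal (f x)) p = ennreal (\<phi>' x) * ennpowr (?H x) q"
      using conjugate_weights(2)[OF p w \<phi>_\<phi>'[OF x]] by (simp add: fF[OF x])
  qed
  moreover have f: "f \<in> FF"
    using \<open>fint f = Hint a\<close> fin Hint_pos[OF a] unfolding FF_iff f_def by auto
  moreover have "bilin f a = Hint a"
    unfolding bilin_eq_H[OF FF_measurable[OF f]] Hint_def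
  \<comment> \<open>Where H is infinite the two integrands differ, one being 0 and the other
    \<infinity>; since Hint a is finite, this happens only on a null set.\<close>
  proof (rule nn_integral_cong_AE)
    have "AE x in L. ennreal (\<phi>' x) * ennpowr (?H x) q \<noteq> \<infinity>"
      using fin unfolding Hint_def by (intro nn_integral_noteq_infinite) auto
    moreover have "AE x in L. 0 < x" by (rule AE_I2) simp
    ultimately show "AE x in L. ennreal (f x) * ?H x = ennreal (\<phi>' x) * ennpowr (?H x) q"
    proof eventually_elim
      fix x :: real assume x: "0 < x" and "ennreal (\<phi>' x) * ennpowr (?H x) q \<noteq> \<infinity>"
      then have "?H x \<noteq> \<infinity>" using q(1) weights_pos(2)[OF x] by (auto simp: ennreal_mult_top)
      then show "ennreal (f x) * ?H x = ennreal (\<phi>' x) * ennpowr (?H x) q"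
        using ennpowr_mult_self[of q "?H x"] q(1,2) by (simp add: fF[OF x] F_def mult.assoc)
    qed
  qed
  ultimately show ?thesis using that by blast
qed

text \<open>Isolated because it puts no bound on C, so the optimality proof can use it for C =
  \<infinity> too.\<close>

lemma ineq1_imp_ineq3_finite:
  assumes "ineq1 C" and a: "a \<in> AA" "Hint a < \<infinity>"
  shows "C * ennpowr (asum a) (1 / q) < ennpowr (Hint a) (1 / q)"
proof -
  from extremal_f[OF a] obtain f where f: "f \<in> FF" "fint f = Hint a" "bilin f a = Hint a" .
  have "C * ennpowr (asum a) (1 / q) * ennpowr (Hint a) (1 / p) < Hint a"
    using assms f unfolding ineq1_def by (metis mult.assoc mult.commute)
  also have "Hint a = ennpowr (Hint a) (1 / q) * ennpowr (Hint a) (1 / p)"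
    using a(2) Hint_pos[OF a(1)] p by (subst ennpowr_add[symmetric]) (auto simp: add.commute)
  finally show ?thesis by (rule ennreal_mult_right_less_cancel)
qed

lemma ineq1_imp_ineq3:
  assumes "ineq1 C" and C: "C < \<infinity>" shows "ineq3 C"
  unfolding ineq3_def
proof
  fix a assume a: "a \<in> AA"
  show "C * ennpowr (asum a) (1 / q) < ennpowr (Hint a) (1 / q)"
  proof (cases "Hint a = \<infinity>")
    case True
    then show ?thesis
      using C a q(1) ennpowr_pos_finite[of "asum a" "1 / q"] by (simp add: AA_iff ennreal_mult_less_top)
  next
    case False
    then show ?thesis using ineq1_imp_ineq3_finite[OF assms(1) a] by (simp add: less_top)
  qed
qed

end

section \<open>Optimality of the constant\<close>

text \<open>Mean value bounds for z powr (- e) with the derivative taken at either end. Both follow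
  from r powr (- e) >= 1 - e * (r - 1), for r = y/x and r = x/y.\<close>

lemma powr_neg_diff_bounds:
  fixes x y e :: real
  assumes "0 < x" "x \<le> y" "0 < e"
  shows "x powr (- e) - y powr (- e) \<le> e * ((y - x) * x powr (- 1 - e))"
    and "e * ((y - x) * y powr (- 1 - e)) \<le> x powr (- e) - y powr (- e)"
proof -
  have y: "0 < y" using assms by simp
  have p1: "z powr (- 1 - e) = z powr (- e) / z" if "0 < z" for z
    using that by (simp add: powr_diff powr_minus field_simps)
  have key: "1 - e * (r - 1) \<le> r powr (- e)" if "0 < r" for r :: real
  proof -
    have "1 - e * (r - 1) \<le> 1 + - e * ln r" using ln_le_minus_one[OF that] assms(3) by simp
    also have "\<dots> \<le> r powr (- e)" using exp_ge_add_one_self[of "- e * ln r"] that by (simp add: powr_def)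
    finally show ?thesis .
  qed
  have "x powr (- e) * (1 - e * (y / x - 1)) \<le> x powr (- e) * (y / x) powr (- e)"
    using key[of "y / x"] assms y by (intro mult_left_mono) auto
  also have "\<dots> = y powr (- e)" using assms y by (simp add: powr_divide)
  finally show "x powr (- e) - y powr (- e) \<le> e * ((y - x) * x powr (- 1 - e))"
    using assms by (simp add: p1 field_simps)
  have "y powr (- e) * (1 - e * (x / y - 1)) \<le> y powr (- e) * (x / y) powr (- e)"
    using key[of "x / y"] assms y by (intro mult_left_mono) auto
  also have "\<dots> = x powr (- e)" using assms y by (simp add: powr_divide)
  finally show "e * ((y - x) * y powr (- 1 - e)) \<le> x powr (- e) - y powr (- e)"
    using assms y by (simp add: p1 field_simps)
qed

lemma nn_integral_powr_0_1:
  fixes e :: real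
  assumes "0 < e" shows "(\<integral>\<^sup>+y\<in>{0<..1}. ennreal (y powr (e - 1)) \<partial>lborel) = ennreal (1 / e)"
proof -
  have "(\<integral>\<^sup>+y\<in>{0..1}. ennreal (y powr (e - 1)) \<partial>lborel) = ennreal (1 / e)"
    using has_integral_powr_from_0[of "e - 1" 1] assms by (intro nn_integral_has_integral_lebesgue') auto
  moreover have "(\<integral>\<^sup>+y\<in>{0<..1}. ennreal (y powr (e - 1)) \<partial>lborel) = (\<integral>\<^sup>+y\<in>{0..1}. ennreal (y powr (e - 1)) \<partial>lborel)"
    by (intro nn_integral_cong) (auto simp: indicator_def)
  ultimately show ?thesis by simp
qed

lemma nn_integral_powr_1_top:
  fixes e :: real
  assumes "0 < e" shows "(\<integral>\<^sup>+y\<in>{1..}. ennreal (y powr (- e - 1)) \<partial>lborel) = ennreal (1 / e)"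
  using has_integral_powr_to_inf[of "- e - 1" 1] assms by (intro nn_integral_has_integral_lebesgue') auto

context half_discrete
begin

lemma V_Suc: "V (Suc n) = V n + \<nu> (Suc (Suc n))"
  by (simp add: V_def psum_Suc)

lemma V_mono: "V 0 \<le> V n"
proof -
  have "V k \<le> V (Suc k)" for k using \<nu>_pos[of "Suc (Suc k)"] by (simp add: V_Suc)
  then show ?thesis by (rule lift_Suc_mono_le) simp
qed

lemma V_powr_telescope:
  assumes "0 < e"
  shows "(\<lambda>n. (V n powr (- e) - V (Suc n) powr (- e)) / e) sums (V 0 powr (- e) / e)"
proof -
  have "filterlim (\<lambda>n. psum \<nu> (Suc n)) at_top sequentially"
    using psum_at_top by (rule filterlim_compose[OF _ filterlim_Suc])
  then have "filterlim V at_top sequentially"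
    unfolding V_def using filterlim_tendsto_add_at_top[OF tendsto_const[of "- \<beta>"], of "\<lambda>n. psum \<nu> (Suc n)"] by simp
  then have "(\<lambda>n. V n powr (- e)) \<longlonglongrightarrow> 0" using assms by (intro tendsto_neg_powr) auto
  from sums_divide[OF telescope_sums'[OF this], of e] show ?thesis by simp
qed

text \<open>Comparison with a telescoping series: the left-end bound gives the lower estimate of
  order 1/e, the right-end bound gives convergence. Divergence of V makes the telescoped value
  exactly V 0 powr (- e) / e.\<close>

lemma V_powr_sum:
  assumes "0 < e"
  shows "summable (\<lambda>n. \<nu> (Suc (Suc n)) * V n powr (- 1 - e))"
    and "ennreal (V 0 powr (- e) / e) \<le> (\<Sum>n. ennreal (\<nu> (Suc (Suc n)) * V n powr (- 1 - e)))"
proof -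
  have le: "V n \<le> V (Suc n)" for n using \<nu>_pos[of "Suc (Suc n)"] by (simp add: V_Suc)
  note bounds = powr_neg_diff_bounds[OF V_pos le assms]
  \<comment> \<open>The right-end bound pairs V (Suc n) with the step \<nu> (Suc (Suc n)), one index
    too early; monotonicity of \<nu> repairs the shift.\<close>
  have "summable (\<lambda>n. \<nu> (Suc (Suc (Suc n))) * V (Suc n) powr (- 1 - e))"
  proof (rule summable_comparison_test'[OF sums_summable[OF V_powr_telescope[OF assms]]])
    fix n
    have "\<nu> (Suc (Suc (Suc n))) * V (Suc n) powr (- 1 - e) \<le> (V (Suc n) - V n) * V (Suc n) powr (- 1 - e)"
      using \<nu>_mono[of "Suc (Suc n)"] by (intro mult_right_mono) (auto simp: V_Suc)
    also have "\<dots> \<le> (V n powr (- e) - V (Suc n) powr (- e)) / e"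
      using bounds(2)[of n] assms by (simp add: pos_le_divide_eq mult.commute)
    finally show "norm (\<nu> (Suc (Suc (Suc n))) * V (Suc n) powr (- 1 - e)) \<le> (V n powr (- e) - V (Suc n) powr (- e)) / e"
      using \<nu>_pos[of "Suc (Suc (Suc n))"] by simp
  qed
  then show "summable (\<lambda>n. \<nu> (Suc (Suc n)) * V n powr (- 1 - e))" by (subst (asm) summable_Suc_iff)
  have nn: "0 \<le> (V n powr (- e) - V (Suc n) powr (- e)) / e" for n
    using assms le[of n] V_pos[of n] by (intro divide_nonneg_pos) (auto intro!: powr_mono2')
  have "ennreal (V 0 powr (- e) / e) = (\<Sum>n. ennreal ((V n powr (- e) - V (Suc n) powr (- e)) / e))"
    using suminf_ennreal_eq[OF nn V_powr_telescope[OF assms]] by simp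
  also have "\<dots> \<le> (\<Sum>n. ennreal (\<nu> (Suc (Suc n)) * V n powr (- 1 - e)))"
    using bounds(1) assms
    by (intro suminf_le ennreal_leI) (auto simp: pos_divide_le_eq V_Suc mult.commute)
  finally show "ennreal (V 0 powr (- e) / e) \<le> (\<Sum>n. ennreal (\<nu> (Suc (Suc n)) * V n powr (- 1 - e)))" .
qed

section \<open>The test sequences\<close>

text \<open>For e = 0 the norm would be the divergent series of \<nu>_(n+1) / v_n; lowering the
  exponent by e only just restores convergence.\<close>

definition test :: "real \<Rightarrow> nat \<Rightarrow> real" where
  "test e n = \<nu> (Suc n) * (psum \<nu> n - \<beta>) powr (\<sigma> - e - 1)"

lemma test_Suc: "test e (Suc n) = \<nu> (Suc (Suc n)) * V n powr (\<sigma> - e - 1)"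
  by (simp add: test_def V_def)

lemma asum_test: "asum (test e) = (\<Sum>n. ennreal (\<nu> (Suc (Suc n)) * V n powr (- 1 - q * e)))"
  unfolding asum_def
proof (intro suminf_cong)
  fix n
  have pos: "0 < V n" "0 < \<nu> (Suc (Suc n))" using V_pos \<nu>_pos by auto
  have "ln (\<psi> n * test e (Suc n) powr q) = ln (\<nu> (Suc (Suc n)) * V n powr (- 1 - q * e))"
    using pos by (simp add: \<psi>_def Psi_def V_def[symmetric] test_Suc ln_mult ln_powr ln_div algebra_simps)
  moreover have "0 < \<psi> n * test e (Suc n) powr q" using pos weights_pos(3)[of n] by (simp add: test_Suc)
  ultimately have "\<psi> n * test e (Suc n) powr q = \<nu> (Suc (Suc n)) * V n powr (- 1 - q * e)"
    using pos by simp
  moreover have "0 < test e (Suc n)" using pos by (simp add: test_Suc)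
  ultimately show "ennreal (\<psi> n) * ennpowr (ennreal (test e (Suc n))) q = ennreal (\<nu> (Suc (Suc n)) * V n powr (- 1 - q * e))"
    using weights_pos(3)[of n] by (simp add: ennpowr_ennreal ennreal_mult'[symmetric] less_imp_le)
qed

lemma test_in_AA:
  assumes "0 < e" shows "test e \<in> AA" "ennreal (V 0 powr (- (q * e)) / (q * e)) \<le> asum (test e)"
proof -
  have qe: "0 < q * e" using assms q(1) by simp
  show le: "ennreal (V 0 powr (- (q * e)) / (q * e)) \<le> asum (test e)"
    unfolding asum_test by (rule V_powr_sum(2)[OF qe])
  have "0 < ennreal (V 0 powr (- (q * e)) / (q * e))" using qe V_pos[of 0] by simp
  then have "0 < asum (test e)" using le by (rule less_le_trans)
  moreover have "asum (test e) < \<infinity>"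
    unfolding asum_test using V_powr_sum(1)[OF qe] \<nu>_pos
    by (subst suminf_ennreal2) (auto simp: less_imp_le)
  moreover have "0 \<le> test e n" if "1 \<le> n" for n using \<nu>_pos[of "Suc n"] by (simp add: test_def)
  ultimately show "test e \<in> AA" by (simp add: AA_iff)
qed

lemma H_test_eq: "H (\<lambda>n. ennreal (test e (Suc n))) x = (\<Sum>n. ennreal (\<nu> (Suc (Suc n)) * (K x n * V n powr (\<sigma> - e - 1))))"
  if "0 < x"
  unfolding H_def using K_pos[OF that] \<nu>_pos
  by (intro suminf_cong) (simp add: test_Suc ennreal_mult'[symmetric] less_imp_le mult_ac)

text \<open>The factors stem from \<open>hker_le\<close> at s = \<sigma> + 1, from a bound of V n
  powr (- e') valid for all 0 <= e' <= e, and from the series that the decay V n powr (- 2) makes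
  convergent.\<close>

definition tail_const :: "real \<Rightarrow> real" where
  "tail_const e = (\<sigma> + 1) * enn2real (kconst \<alpha> \<rho> \<gamma> (\<sigma> + 1)) * (V 0 powr (- e) + 1)
     * (\<Sum>n. \<nu> (Suc (Suc n)) * V n powr (- 1 - 1))"

(* Uniform in e, because the integral of hker against a larger power controls hker at infinity. *)
lemma H_test_le_tail:
  assumes "0 < x" "0 \<le> e" "e \<le> e'"
  shows "H (\<lambda>n. ennreal (test e (Suc n))) x \<le> ennreal (tail_const e' * W x powr (- (\<sigma> + 1)))"
proof -
  let ?c = "(\<sigma> + 1) * enn2real (kconst \<alpha> \<rho> \<gamma> (\<sigma> + 1))"
  have c: "0 \<le> ?c" using \<gamma> by simp
  have w: "0 < W x" using W_pos assms by simp
  let ?d = "?c * (V 0 powr (- e') + 1) * W x powr (- (\<sigma> + 1))"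
  have "\<nu> (Suc (Suc n)) * (K x n * V n powr (\<sigma> - e - 1)) \<le> ?d * (\<nu> (Suc (Suc n)) * V n powr (- 1 - 1))" for n
  proof -
    note v = V_pos[of n]
    have K: "K x n \<le> ?c * (W x * V n) powr (- (\<sigma> + 1))"
      unfolding K_def using hker_le[OF \<rho> \<gamma>(1), of "\<sigma> + 1" "W x * V n"] \<gamma> w v by simp
    have "V n powr (- e) \<le> V 0 powr (- e)" using V_mono[of n] V_pos[of 0] assms by (intro powr_mono2') auto
    \<comment> \<open>The base V 0 may lie on either side of 1; the first summand serves V 0 <= 1,
      the second V 0 > 1.\<close>
    also have "V 0 powr (- e) \<le> V 0 powr (- e') + 1"
    proof (cases "V 0 \<le> 1")
      case True
      then have "V 0 powr (- e) \<le> V 0 powr (- e')" using V_pos[of 0] assms by (intro powr_mono') auto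
      then show ?thesis by simp
    next
      case False
      then have "V 0 powr (- e) \<le> V 0 powr 0" using assms by (intro powr_mono) auto
      then show ?thesis using False by (simp add: add_increasing)
    qed
    finally have Ve: "V n powr (- e) \<le> V 0 powr (- e') + 1" .
    have "K x n * V n powr (\<sigma> - e - 1) \<le> ?c * (W x * V n) powr (- (\<sigma> + 1)) * V n powr (\<sigma> - e - 1)"
      using K by (rule mult_right_mono) simp
    also have "\<dots> = ?c * W x powr (- (\<sigma> + 1)) * (V n powr (- (\<sigma> + 1)) * V n powr (\<sigma> - e - 1))"
      using w v by (simp add: powr_mult)
    also have "V n powr (- (\<sigma> + 1)) * V n powr (\<sigma> - e - 1) = V n powr (- 1 - 1) * V n powr (- e)"
      by (simp flip: powr_add)
    also have "?c * W x powr (- (\<sigma> + 1)) * (V n powr (- 1 - 1) * V n powr (- e))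
      \<le> ?c * W x powr (- (\<sigma> + 1)) * (V n powr (- 1 - 1) * (V 0 powr (- e') + 1))"
      by (intro mult_left_mono Ve mult_nonneg_nonneg[OF c]) simp_all
    finally have "K x n * V n powr (\<sigma> - e - 1) \<le> ?d * V n powr (- 1 - 1)" by (simp only: mult_ac)
    then have "\<nu> (Suc (Suc n)) * (K x n * V n powr (\<sigma> - e - 1)) \<le> \<nu> (Suc (Suc n)) * (?d * V n powr (- 1 - 1))"
      using \<nu>_pos[of "Suc (Suc n)"] by (intro mult_left_mono) auto
    also have "\<dots> = ?d * (\<nu> (Suc (Suc n)) * V n powr (- 1 - 1))" by (rule mult.left_commute)
    finally show ?thesis .
  qed
  then have "H (\<lambda>n. ennreal (test e (Suc n))) x \<le> (\<Sum>n. ennreal (?d * (\<nu> (Suc (Suc n)) * V n powr (- 1 - 1))))"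
    unfolding H_test_eq[OF assms(1)] by (intro suminf_le ennreal_leI) auto
  also have "\<dots> = ennreal (?d * (\<Sum>n. \<nu> (Suc (Suc n)) * V n powr (- 1 - 1)))"
    using c \<nu>_pos V_powr_sum(1)[of 1]
    by (intro suminf_ennreal_eq sums_mult summable_sums) (auto intro!: mult_nonneg_nonneg simp: less_imp_le)
  finally show ?thesis by (simp add: tail_const_def mult_ac)
qed

text \<open>The integral is split at W x = 1. Below, the summation weight at \<sigma> - e leaves y
  powr (q * e - 1) with integral 1 / (q * e). Above 1 that power is not integrable, and the tail
  bound leaves y powr (- q - 1), whose integral 1 / q stays bounded in e.\<close>

lemma Hint_test_le:
  assumes e: "0 < e" "\<gamma> < \<sigma> - e" "e \<le> e'"
  shows "Hint (test e) \<le> ennreal (enn2real (kconst \<alpha> \<rho> \<gamma> (\<sigma> - e)) powr q / (q * e) + tail_const e' powr q / q)"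
proof -
  define k where "k = enn2real (kconst \<alpha> \<rho> \<gamma> (\<sigma> - e))"
  define t where "t = tail_const e'"
  have q0: "0 < q" by (rule q(1))
  have k: "kconst \<alpha> \<rho> \<gamma> (\<sigma> - e) = ennreal k" using kconst_finite[OF \<rho> \<gamma>(1) e(2)] by (simp add: k_def)
  let ?g1 = "\<lambda>y::real. k powr q * y powr (q * e - 1)" and ?g2 = "\<lambda>y::real. t powr q * y powr (- q - 1)"
  define G where "G y = (if y \<le> 1 then ?g1 y else ?g2 y)" for y :: real
  have [measurable]: "G \<in> borel_measurable borel" unfolding G_def by measurable
  let ?H = "H (\<lambda>n. ennreal (test e (Suc n)))"
  have pt: "ennreal (\<phi>' x) * ennpowr (?H x) q \<le> ennreal (G (prim \<mu> x powr \<delta>) * (prim \<mu> x powr (\<delta> - 1) * \<mu> x))"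
    if x: "0 < x" for x
  proof -
    have w: "0 < W x" by (rule W_pos[OF x])
    have b: "ennreal (\<phi>' x) * ennpowr (?H x) q \<le> ennreal (\<phi>' x * (c powr q * W x powr (r * q)))"
      if "?H x \<le> ennreal (c * W x powr r)" for c r
    proof -
      \<comment> \<open>Positivity of either constant comes for free, since H is positive.\<close>
      have "0 < ennreal (c * W x powr r)" using H_pos[OF test_in_AA(1)[OF e(1)] x] that by (rule less_le_trans)
      then have c: "0 < c" using w by (simp add: zero_less_mult_iff)
      have "ennpowr (?H x) q \<le> ennpowr (ennreal (c * W x powr r)) q" by (rule ennpowr_mono[OF q0 that])
      also have "\<dots> = ennreal (c powr q * W x powr (r * q))"
        using c w by (simp add: ennpowr_ennreal powr_mult powr_powr)
      finally have "ennreal (\<phi>' x) * ennpowr (?H x) q \<le> ennreal (\<phi>' x) * ennreal (c powr q * W x powr (r * q))"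
        by (rule mult_left_mono) simp
      then show ?thesis using weights_pos(2)[OF x] by (simp add: ennreal_mult'[symmetric])
    qed
    have \<phi>'_eq: "\<phi>' x * W x powr r = W x powr (q * \<sigma> - 1 + r) * (prim \<mu> x powr (\<delta> - 1) * \<mu> x)" for r
    proof -
      have "1 / prim \<mu> x powr (1 - q * \<delta> * \<sigma>) = W x powr (q * \<sigma> - 1) * prim \<mu> x powr (\<delta> - 1)"
        using prim_pos[OF x] by (simp add: W_def powr_powr algebra_simps flip: powr_add powr_minus_divide)
      then have "\<phi>' x = W x powr (q * \<sigma> - 1) * prim \<mu> x powr (\<delta> - 1) * \<mu> x"
        by (simp add: \<phi>'_def divide_inverse mult_ac)
      then show ?thesis using w by (simp add: powr_add mult_ac)
    qed
    show ?thesis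
    proof (cases "W x \<le> 1")
      case True
      have "?H x < ennreal (W x powr (- (\<sigma> - e))) * ennreal k"
        unfolding H_test_eq[OF x] k[symmetric] using sum_K_less[OF x e(2)] \<sigma> e by simp
      then have "?H x \<le> ennreal (k * W x powr (- (\<sigma> - e)))" by (simp add: ennreal_mult'' mult.commute less_imp_le)
      from b[OF this] have "ennreal (\<phi>' x) * ennpowr (?H x) q \<le> ennreal (k powr q * (\<phi>' x * W x powr (- (\<sigma> - e) * q)))"
        by (simp only: mult_ac)
      also have "\<phi>' x * W x powr (- (\<sigma> - e) * q) = W x powr (q * e - 1) * (prim \<mu> x powr (\<delta> - 1) * \<mu> x)"
        unfolding \<phi>'_eq by (simp add: algebra_simps)
      finally show ?thesis using True by (simp add: G_def W_def mult.assoc)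
    next
      case False
      have "?H x \<le> ennreal (t * W x powr (- (\<sigma> + 1)))"
        unfolding t_def using e by (intro H_test_le_tail x) auto
      from b[OF this] have "ennreal (\<phi>' x) * ennpowr (?H x) q \<le> ennreal (t powr q * (\<phi>' x * W x powr (- (\<sigma> + 1) * q)))"
        by (simp only: mult_ac)
      also have "\<phi>' x * W x powr (- (\<sigma> + 1) * q) = W x powr (- q - 1) * (prim \<mu> x powr (\<delta> - 1) * \<mu> x)"
      proof -
        have "q * \<sigma> - 1 + - (\<sigma> + 1) * q = - q - 1" by (simp add: algebra_simps)
        then show ?thesis unfolding \<phi>'_eq by (simp only:)
      qed
      finally show ?thesis using False by (simp add: G_def W_def mult.assoc)
    qed
  qed
  have "Hint (test e) \<le> (\<integral>\<^sup>+x. ennreal (G (prim \<mu> x powr \<delta>) * (prim \<mu> x powr (\<delta> - 1) * \<mu> x)) \<partial>L)"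
    unfolding Hint_def using pt by (intro nn_integral_mono) auto
  also have "\<dots> = (\<integral>\<^sup>+y\<in>{0<..}. ennreal (G y) \<partial>lborel)"
    unfolding nn_integral_L nn_integral_completion by (rule nn_integral_prim_powr[OF \<delta>]) measurable
  also have "\<dots> \<le> (\<integral>\<^sup>+y. ennreal (k powr q) * (ennreal (y powr (q * e - 1)) * indicator {0<..1} y)
      + ennreal (t powr q) * (ennreal (y powr (- q - 1)) * indicator {1..} y) \<partial>lborel)"
  proof (intro nn_integral_mono)
    fix y :: real
    consider "y \<le> 0" | "0 < y" "y \<le> 1" | "1 < y" by linarith
    then show "ennreal (G y) * indicator {0<..} y \<le> ennreal (k powr q) * (ennreal (y powr (q * e - 1)) * indicator {0<..1} y)
      + ennreal (t powr q) * (ennreal (y powr (- q - 1)) * indicator {1..} y)"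
      by cases (simp_all add: G_def ennreal_mult)
  qed
  also have "\<dots> = ennreal (k powr q) * ennreal (1 / (q * e)) + ennreal (t powr q) * ennreal (1 / q)"
    using e q0 by (subst nn_integral_add) (simp_all add: nn_integral_cmult nn_integral_powr_0_1 nn_integral_powr_1_top)
  also have "\<dots> = ennreal (k powr q / (q * e) + t powr q / q)"
    using e q0 by (simp add: ennreal_mult'[symmetric] ennreal_plus)
  finally show ?thesis by (simp add: k_def t_def)
qed

lemma extremal_a:
  assumes c: "kr < c"
  obtains a where "a \<in> AA" "Hint a < \<infinity>" "ennpowr (Hint a) (1 / q) \<le> ennreal c * ennpowr (asum a) (1 / q)"
proof -
  \<comment> \<open>Half the gap, so that \<sigma> - e stays above \<gamma> for all e <= \<eta> and
    every k(\<sigma> - e) is finite.\<close>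
  define \<eta> where "\<eta> = (\<sigma> - \<gamma>) / 2"
  have \<eta>: "0 < \<eta>" "\<gamma> < \<sigma> - \<eta>" using \<gamma> by (auto simp: \<eta>_def field_simps)
  define e where "e n = \<eta> / real (Suc n)" for n
  have e: "0 < e n" "e n \<le> \<eta>" for n using \<eta> by (auto simp: e_def divide_simps mult_left_mono)
  have e': "\<gamma> < \<sigma> - e n" for n using e(2)[of n] \<eta> by simp
  have q0: "0 < q" by (rule q(1))
  have e0: "e \<longlonglongrightarrow> 0" unfolding e_def using LIMSEQ_Suc[OF lim_const_over_n[of \<eta>]] by simp
  define k where "k n = enn2real (kconst \<alpha> \<rho> \<gamma> (\<sigma> - e n))" for n
  have "k \<longlonglongrightarrow> kr"
    unfolding k_def e_def
    by (rule tendsto_enn2real[OF kconst_tendsto[OF \<rho> \<gamma>(1) \<eta>, unfolded kr(1)] less_imp_le[OF kr(2)]])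
  \<comment> \<open>Multiplication by q * e n removes the growth 1/e. The two sides then tend to kr
    powr q and c powr q, and the tail contribution disappears.\<close>
  then have lim1: "(\<lambda>n. k n powr q + q * e n * (tail_const \<eta> powr q / q)) \<longlonglongrightarrow> kr powr q + q * 0 * (tail_const \<eta> powr q / q)"
    using kr(2) e0 by (intro tendsto_intros) auto
  have lim2: "(\<lambda>n. c powr q * V 0 powr (- (q * e n))) \<longlonglongrightarrow> c powr q * V 0 powr (- (q * 0))"
    using e0 V_pos[of 0] by (intro tendsto_intros) auto
  have "kr powr q + q * 0 * (tail_const \<eta> powr q / q) < c powr q * V 0 powr (- (q * 0))"
    using c kr(2) q0 V_pos[of 0] by (simp add: powr_less_mono2)
  then have "0 < c powr q * V 0 powr (- (q * 0)) - (kr powr q + q * 0 * (tail_const \<eta> powr q / q))" by simp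
  from order_tendstoD(1)[OF tendsto_diff[OF lim2 lim1] this]
  obtain n where n: "k n powr q + q * e n * (tail_const \<eta> powr q / q) < c powr q * V 0 powr (- (q * e n))"
    by (auto simp: eventually_sequentially)
  have qe: "0 < q * e n" using q0 e(1) by simp
  have "k n powr q / (q * e n) + tail_const \<eta> powr q / q = (k n powr q + q * e n * (tail_const \<eta> powr q / q)) / (q * e n)"
    using q0 e(1)[of n] by (simp add: add_divide_distrib)
  also have "\<dots> \<le> c powr q * V 0 powr (- (q * e n)) / (q * e n)"
    using n qe by (intro divide_right_mono) auto
  finally have le: "k n powr q / (q * e n) + tail_const \<eta> powr q / q \<le> c powr q * (V 0 powr (- (q * e n)) / (q * e n))"
    by simp
  let ?a = "test (e n)"
  have "Hint ?a \<le> ennreal (k n powr q / (q * e n) + tail_const \<eta> powr q / q)"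
    unfolding k_def by (rule Hint_test_le[OF e(1) e' e(2)])
  also have "\<dots> \<le> ennreal (c powr q) * ennreal (V 0 powr (- (q * e n)) / (q * e n))"
    using le by (simp only: ennreal_mult'[symmetric] powr_ge_zero ennreal_leI)
  also have "\<dots> \<le> ennreal (c powr q) * asum ?a"
    using test_in_AA(2)[OF e(1)] by (rule mult_left_mono) simp
  finally have H: "Hint ?a \<le> ennreal (c powr q) * asum ?a" .
  have a: "?a \<in> AA" by (rule test_in_AA(1)[OF e(1)])
  have "Hint ?a < \<infinity>" using le_less_trans[OF H] a by (simp add: AA_iff ennreal_mult_less_top)
  moreover have "ennpowr (Hint ?a) (1 / q) \<le> ennreal c * ennpowr (asum ?a) (1 / q)"
    using ennpowr_mono[OF _ H, of "1 / q"] c kr(2) q0 by (simp add: ennpowr_cmult powr_powr)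
  ultimately show ?thesis using that a by blast
qed

lemma not_ineq1:
  assumes "kconst \<alpha> \<rho> \<gamma> \<sigma> < C" shows "\<not> ineq1 C"
proof
  assume 1: "ineq1 C"
  \<comment> \<open>C may be \<infinity>; a constant strictly in between is finite and can be tested
    as a real number.\<close>
  from dense[OF assms] obtain C' where C': "kconst \<alpha> \<rho> \<gamma> \<sigma> < C'" "C' < C" by blast
  have "C' < top" using C'(2) top_greatest by (rule less_le_trans)
  then obtain c where c: "0 \<le> c" "C' = ennreal c" by (cases C' rule: ennreal_cases) auto
  then have "kr < c" using C'(1) kr by (simp add: ennreal_less_iff)
  from extremal_a[OF this] obtain a where a: "a \<in> AA" "Hint a < \<infinity>"
    "ennpowr (Hint a) (1 / q) \<le> ennreal c * ennpowr (asum a) (1 / q)" .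
  have "C * ennpowr (asum a) (1 / q) < ennpowr (Hint a) (1 / q)"
    by (rule ineq1_imp_ineq3_finite[OF 1 a(1,2)])
  also have "\<dots> \<le> C * ennpowr (asum a) (1 / q)"
    using a(3) C'(2) c by (elim order_trans) (auto intro!: mult_right_mono)
  finally show False by simp
qed

text \<open>A by-product of optimality that discharges the finiteness condition in the transfers, so
  that the equivalences hold for every C in [0,\<infinity>].\<close>

lemma ineq1_finite: "ineq1 C \<Longrightarrow> C < \<infinity>"
  using not_ineq1[of C] kr by (cases "C = top") (auto simp: less_top)

lemma ineq1_iff_ineq2: "ineq1 C \<longleftrightarrow> ineq2 C"
  using ineq1_imp_ineq2 ineq2_imp_ineq1 ineq1_finite by blast

lemma ineq1_iff_ineq3: "ineq1 C \<longleftrightarrow> ineq3 C"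
  using ineq1_imp_ineq3 ineq3_imp_ineq1 ineq1_finite by blast

section \<open>Return to the notation of the theorem\<close>

lemma ineq1_statement:
  "ineq1 C \<longleftrightarrow> (\<forall>f\<in>fclass p (Phi p \<sigma> \<delta> \<mu>). \<forall>a\<in>aclass q (Psi q \<sigma> \<beta> \<nu>).
      C * fnorm p (Phi p \<sigma> \<delta> \<mu>) f * anorm q (Psi q \<sigma> \<beta> \<nu>) a
      < (\<Sum>n. \<integral>\<^sup>+x\<in>{0<..}. ennreal (csch_kernel \<alpha> \<rho> \<gamma> \<beta> \<delta> \<mu> \<nu> x (Suc n)) * ennreal (a (Suc n)) * ennreal (f x) \<partial>lebesgue))"
  unfolding ineq1_def \<phi>_def[symmetric] fnorm_eq anorm_eq
  by (intro ball_cong refl) (simp only: bilin_eq[OF FF_measurable])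

lemma ineq2_statement:
  "ineq2 C \<longleftrightarrow> (\<forall>f\<in>fclass p (Phi p \<sigma> \<delta> \<mu>). C * fnorm p (Phi p \<sigma> \<delta> \<mu>) f
      < ennpowr (\<Sum>n. ennreal (\<nu> (Suc (Suc n)) / (psum \<nu> (Suc n) - \<beta>) powr (1 - p * \<sigma>))
          * ennpowr (\<integral>\<^sup>+x\<in>{0<..}. ennreal (csch_kernel \<alpha> \<rho> \<gamma> \<beta> \<delta> \<mu> \<nu> x (Suc n)) * ennreal (f x) \<partial>lebesgue) p) (1 / p))"
  unfolding ineq2_def \<phi>_def[symmetric] fnorm_eq Jsum_def J_eq \<psi>'_def V_def ..

lemma ineq3_statement:
  "ineq3 C \<longleftrightarrow> (\<forall>a\<in>aclass q (Psi q \<sigma> \<beta> \<nu>). C * anorm q (Psi q \<sigma> \<beta> \<nu>) a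
      < ennpowr (\<integral>\<^sup>+x\<in>{0<..}. ennreal (\<mu> x / prim \<mu> x powr (1 - q * \<delta> * \<sigma>))
          * ennpowr (\<Sum>n. ennreal (csch_kernel \<alpha> \<rho> \<gamma> \<beta> \<delta> \<mu> \<nu> x (Suc n)) * ennreal (a (Suc n))) q \<partial>lebesgue) (1 / q))"
  unfolding ineq3_def anorm_eq Hint_eq ..

end

theorem theorem4p1:
  fixes \<alpha> \<rho> \<gamma> \<sigma> \<beta> \<delta> p q :: real
    and \<mu> :: "real \<Rightarrow> real" and \<nu> :: "nat \<Rightarrow> real"
  assumes "\<rho> > max 0 (- \<alpha>)" and "0 < \<gamma>" and "\<gamma> < \<sigma>" and "\<sigma> \<le> 1"
    and "\<delta> \<in> {- 1, 1}"
    and "p < 0" and "1 / p + 1 / q = 1"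
    and "\<And>n. n \<ge> 1 \<Longrightarrow> \<nu> n > 0" and "\<And>n. n \<ge> 1 \<Longrightarrow> \<nu> (Suc n) \<le> \<nu> n"
    and "\<beta> \<le> \<nu> 1 / 2"
    and "filterlim (psum \<nu>) at_top sequentially"
    and "continuous_on {0<..} \<mu>" and "\<And>x. x > 0 \<Longrightarrow> \<mu> x > 0"
    and "\<And>x. x > 0 \<Longrightarrow> set_integrable lborel {0<..<x} \<mu>"
    and "filterlim (prim \<mu>) at_top at_top"
  shows
    "let K = (\<lambda>x n. ennreal (csch_kernel \<alpha> \<rho> \<gamma> \<beta> \<delta> \<mu> \<nu> x n));
         k = kconst \<alpha> \<rho> \<gamma> \<sigma>;
         F = fclass p (Phi p \<sigma> \<delta> \<mu>); normF = fnorm p (Phi p \<sigma> \<delta> \<mu>);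
         A = aclass q (Psi q \<sigma> \<beta> \<nu>); normA = anorm q (Psi q \<sigma> \<beta> \<nu>);
         ineq1 = (\<lambda>C. \<forall>f\<in>F. \<forall>a\<in>A.
           (\<Sum>n. \<integral>\<^sup>+x\<in>{0<..}. K x (Suc n) * ennreal (a (Suc n)) * ennreal (f x) \<partial>lebesgue)
             > C * normF f * normA a);
         ineq2 = (\<lambda>C. \<forall>f\<in>F.
           ennpowr
             (\<Sum>n. ennreal (\<nu> (Suc (Suc n)) / (psum \<nu> (Suc n) - \<beta>) powr (1 - p * \<sigma>))
                * ennpowr (\<integral>\<^sup>+x\<in>{0<..}. K x (Suc n) * ennreal (f x) \<partial>lebesgue) p)
             (1 / p)
             > C * normF f);
         ineq3 = (\<lambda>C. \<forall>a\<in>A.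
           ennpowr
             (\<integral>\<^sup>+x\<in>{0<..}. ennreal (\<mu> x / prim \<mu> x powr (1 - q * \<delta> * \<sigma>))
                * ennpowr (\<Sum>n. K x (Suc n) * ennreal (a (Suc n))) q \<partial>lebesgue)
             (1 / q)
             > C * normA a)
     in k = ennreal (2 * Gamma (\<sigma> / \<gamma>) / (\<gamma> * (2 * \<rho>) powr (\<sigma> / \<gamma>))
                       * hurwitz_zeta (\<sigma> / \<gamma>) ((\<alpha> + \<rho>) / (2 * \<rho>)))
      \<and> ineq1 k \<and> ineq2 k \<and> ineq3 k
      \<and> (\<forall>C. ineq1 C \<longleftrightarrow> ineq2 C) \<and> (\<forall>C. ineq2 C \<longleftrightarrow> ineq3 C)
      \<and> (\<forall>C>k. \<not> ineq1 C) \<and> (\<forall>C>k. \<not> ineq2 C) \<and> (\<forall>C>k. \<not> ineq3 C)"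
proof -
  interpret half_discrete \<mu> \<alpha> \<rho> \<gamma> \<sigma> \<beta> \<delta> p q \<nu>
    using assms by unfold_locales auto
  have "ineq1 (kconst \<alpha> \<rho> \<gamma> \<sigma>)" by (rule ineq2_imp_ineq1[OF ineq2_kconst])
  then show ?thesis
    unfolding Let_def ineq1_statement[symmetric] ineq2_statement[symmetric] ineq3_statement[symmetric]
    using kconst_closed_form[OF \<rho> \<gamma>] ineq1_iff_ineq2 ineq1_iff_ineq3 not_ineq1 by blast
qed

end
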